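(* For every uniformly purely unrectifiable set $E\subset\mathbb{R}^n$ there is a real-valued $1$-Lipschitz function $f$ on $\mathbb{R}^n$ such that $$\liminf_{r\searrow0}\ \sup_{\|y\|\le r}\frac{|f(x+y)-f(x)-\langle e,y\rangle|}{r}=0$$ for every $x\in E$ and $e\in\mathbb{R}^n$ with $\|e\|\le1$. In particular, $D^+f(x;y)=\|y\|$ and $D_+f(x;y)=-\|y\|$ for every $x\in E$ and $y\in\mathbb{R}^n$.
   Context: $\mathbb{R}^n$ carries the Euclidean norm $\|\cdot\|$ and inner product $\langle\cdot,\cdot\rangle$; $B(x,r)$ is the open ball; $\mathcal{H}^1$ is one-dimensional Hausdorff measure. Upper and lower directional derivatives: $D^+f(x;y)=\limsup_{t\searrow0}\frac{f(x+ty)-f(x)}{t}$ and $D_+f(x;y)=\liminf_{t\searrow0}\frac{f(x+ty)-f(x)}{t}$. Width. For $e\in\mathbb{R}^n\setminus\{0\}$ and $\alpha\in(0,1]$ let $C_{e,\alpha}=\{x\in\mathbb{R}^n:\langle x,e\rangle\ge\alpha\|x\|\|e\|\}$ and let $\Gamma_{e,\alpha}$ be the set of Lipschitz curves $\gamma:\mathbb{R}\to\mathbb{R}^n$ such that $\gamma'(t)\in C_{e,\alpha}$ for almost every $t\in\mathbb{R}$. For open $G\subset\mathbb{R}^n$ let $w_{e,\alpha}(G)=\sup\{\mathcal{H}^1(G\cap\gamma(\mathbb{R})):\gamma\in\Gamma_{e,\alpha}\}$, and for arbitrary $E\subset\mathbb{R}^n$ let $w_{e,\alpha}(E)=\inf\{w_{e,\alpha}(G):G\supset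 E,\ G\text{ open}\}$. When $e=0$ or $\alpha>1$, $w_{e,\alpha}(E)=0$ for every $E\subset\mathbb{R}^n$. For $x\in E\subset\mathbb{R}^n$ let $\mathcal{N}(E,x)=\{e\in\mathbb{R}^n:(\forall\varepsilon>0)(\exists r>0)\ w_{e,\varepsilon}(B(x,r)\cap E)=0\}$. A set $E\subset\mathbb{R}^n$ is uniformly purely unrectifiable if $\mathcal{N}(E,x)=\mathbb{R}^n$ for every $x\in E$. *)

theory Defs
  imports "HOL-Analysis.Analysis"
begin

text \<open>
  One-dimensional Hausdorff (outer) measure. The covering sets are required to be bounded because
  \<^const>\<open>diameter\<close> is a real number and takes a junk value on unbounded sets. With
  the summands being the diameters themselves, this agrees with length on lines.
\<close>

definition hausdorff1_delta :: "real \<Rightarrow> 'a::metric_space set \<Rightarrow> ennreal" where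
  "hausdorff1_delta \<delta> A =
     (INF U \<in> {U :: nat \<Rightarrow> 'a set.
         A \<subseteq> (\<Union>i. U i) \<and> (\<forall>i. bounded (U i) \<and> diameter (U i) \<le> \<delta>)}.
       \<Sum>i. ennreal (diameter (U i)))"

definition hausdorff1 :: "'a::metric_space set \<Rightarrow> ennreal" where
  "hausdorff1 A = (SUP \<delta> \<in> {0<..}. hausdorff1_delta \<delta> A)"

definition direction_cone :: "'a::euclidean_space \<Rightarrow> real \<Rightarrow> 'a set" where
  "direction_cone e \<alpha> = {x. x \<bullet> e \<ge> \<alpha> * norm x * norm e}"

text \<open>
  The condition on \<open>\<gamma>'\<close> includes its existence at almost every point.
\<close>

definition cone_curves :: "'a::euclidean_space \<Rightarrow> real \<Rightarrow> (real \<Rightarrow> 'a) set" where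
  "cone_curves e \<alpha> =
     {\<gamma>. (\<exists>L. L-lipschitz_on UNIV \<gamma>) \<and>
          (AE t in lebesgue. \<exists>v \<in> direction_cone e \<alpha>. (\<gamma> has_vector_derivative v) (at t))}"

definition open_width :: "'a::euclidean_space \<Rightarrow> real \<Rightarrow> 'a set \<Rightarrow> ennreal" where
  "open_width e \<alpha> G = (SUP \<gamma> \<in> cone_curves e \<alpha>. hausdorff1 (G \<inter> range \<gamma>))"

text \<open>
  The width is meant for \<open>\<alpha> > 0\<close> only; values at \<open>\<alpha> \<le> 0\<close> are never used.
\<close>

definition width :: "'a::euclidean_space \<Rightarrow> real \<Rightarrow> 'a set \<Rightarrow> ennreal" where
  "width e \<alpha> E =
     (if e = 0 \<or> \<alpha> > 1 then 0
      else (INF G \<in> {G. open G \<and> E \<subseteq> G}. open_width e \<alpha> G))"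

definition null_directions :: "'a::euclidean_space set \<Rightarrow> 'a \<Rightarrow> 'a set" where
  "null_directions E x = {e. \<forall>\<epsilon>>0. \<exists>r>0. width e \<epsilon> (ball x r \<inter> E) = 0}"

definition uniformly_purely_unrectifiable :: "'a::euclidean_space set \<Rightarrow> bool" where
  "uniformly_purely_unrectifiable E \<longleftrightarrow> (\<forall>x\<in>E. null_directions E x = UNIV)"

text \<open>
  Difference quotients and the suprema of such are taken in \<^typ>\<open>ereal\<close>, so that no
  boundedness is presupposed.
\<close>

definition upper_dir_deriv :: "('a::real_normed_vector \<Rightarrow> real) \<Rightarrow> 'a \<Rightarrow> 'a \<Rightarrow> ereal" where
  "upper_dir_deriv f x y = Limsup (at_right 0) (\<lambda>t::real. ereal ((f (x + t *\<^sub>R y) - f x) / t))"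

definition lower_dir_deriv :: "('a::real_normed_vector \<Rightarrow> real) \<Rightarrow> 'a \<Rightarrow> 'a \<Rightarrow> ereal" where
  "lower_dir_deriv f x y = Liminf (at_right 0) (\<lambda>t::real. ereal ((f (x + t *\<^sub>R y) - f x) / t))"

end

(*
  By Lindelof's theorem, E has zero width in every direction u and for every aperture. Small open
  covers G of E then carry a small potential phi, the largest measure inside G of a steep curve
  that ends near x, minus a penalty for not ending at x: its gradient is almost u on G and almost
  in the segment [0,u] elsewhere. If f is Lipschitz with constant less than 1, it equals
  sup_x min_a (f x + <a, y - x>) for finitely many slopes a; subtracting from each affine piece a
  potential in the direction a - e changes the gradient to e on G, at a small cost in the Lipschitz
  constant and in the uniform norm. Iterating over a dense sequence of e, with corrections that are
  small relative to the distance to the complement of the previous covers, gives the function.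
*)

theory Submission
  imports Defs
begin

definition steep_curve :: "'a::euclidean_space \<Rightarrow> real \<Rightarrow> (real \<Rightarrow> 'a) \<Rightarrow> bool" where
  "steep_curve u L c \<longleftrightarrow>
     (\<forall>s. c s \<bullet> u = s) \<and> L-lipschitz_on UNIV c \<and>
     (\<exists>S. finite S \<and> (\<forall>t. t \<notin> S \<longrightarrow> c differentiable (at t)))"

definition thin :: "'a::euclidean_space \<Rightarrow> real \<Rightarrow> 'a set \<Rightarrow> bool" where
  "thin u L E \<longleftrightarrow>
     (\<forall>\<tau>>0. \<exists>G. open G \<and> E \<subseteq> G \<and>
        (\<forall>c. steep_curve u L c \<longrightarrow> emeasure lborel {s. c s \<in> G} \<le> ennreal \<tau>))"

lemma norm_vector_derivative_le_lipschitz: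
  fixes c :: "real \<Rightarrow> 'a::real_inner"
  assumes lip: "L-lipschitz_on UNIV c" and der: "(c has_vector_derivative v) (at t)"
  shows "norm v \<le> L"
proof -
  have "((\<lambda>s. c s \<bullet> v) has_real_derivative v \<bullet> v) (at t)"
    using bounded_linear.has_vector_derivative[OF bounded_linear_inner_left der]
    by (simp add: has_real_derivative_iff_has_vector_derivative)
  then have "((\<lambda>s. (c s \<bullet> v - c t \<bullet> v) / (s - t)) \<longlongrightarrow> v \<bullet> v) (at t)"
    by (simp add: has_field_derivative_iff)
  moreover have "\<forall>\<^sub>F s in at t. (c s \<bullet> v - c t \<bullet> v) / (s - t) \<le> L * norm v"
  proof (rule eventuallyI)
    fix s :: real
    have "\<bar>(c s - c t) \<bullet> v\<bar> \<le> norm (c s - c t) * norm v"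
      by (rule Cauchy_Schwarz_ineq2)
    also have "\<dots> \<le> (L * \<bar>s - t\<bar>) * norm v"
      using lipschitz_on_normD[OF lip, of s t] by (intro mult_right_mono) auto
    finally have "\<bar>c s \<bullet> v - c t \<bullet> v\<bar> / \<bar>s - t\<bar> \<le> L * norm v"
      using lipschitz_on_nonneg[OF lip]
      by (cases "s = t") (auto simp: divide_simps inner_diff_left mult_ac)
    then show "(c s \<bullet> v - c t \<bullet> v) / (s - t) \<le> L * norm v"
      by (metis abs_divide abs_le_D1)
  qed
  ultimately have "v \<bullet> v \<le> L * norm v"
    by (rule tendsto_upperbound) simp
  then show ?thesis
    using lipschitz_on_nonneg[OF lip]
    by (cases "v = 0") (auto simp: power2_norm_eq_inner[symmetric] power2_eq_square)
qed

lemma steep_curve_in_cone_curves: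
  fixes u :: "'a::euclidean_space"
  assumes c: "steep_curve u L c" and u: "norm u = 1" and L: "L \<ge> 1"
  shows "c \<in> cone_curves u (1 / L)"
proof -
  from c obtain S where S: "finite S" "\<And>t. t \<notin> S \<Longrightarrow> c differentiable (at t)"
    and cu: "\<And>s. c s \<bullet> u = s" and lip: "L-lipschitz_on UNIV c"
    by (auto simp: steep_curve_def)
  have *: "\<exists>v\<in>direction_cone u (1 / L). (c has_vector_derivative v) (at t)" if "t \<notin> S" for t
  proof -
    from S(2)[OF that] obtain v where v: "(c has_vector_derivative v) (at t)"
      by (metis vector_derivative_works)
    have "((\<lambda>s. c s \<bullet> u) has_vector_derivative v \<bullet> u) (at t)"
      by (rule bounded_linear.has_vector_derivative[OF bounded_linear_inner_left v])
    moreover have "((\<lambda>s. c s \<bullet> u) has_vector_derivative 1) (at t)"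
      by (simp add: cu)
    ultimately have "v \<bullet> u = 1"
      by (rule vector_derivative_unique_at)
    moreover have "norm v \<le> L"
      by (rule norm_vector_derivative_le_lipschitz[OF lip v])
    ultimately have "v \<in> direction_cone u (1 / L)"
      using u L by (simp add: direction_cone_def)
    with v show ?thesis by blast
  qed
  have "AE t in lebesgue. t \<notin> S"
    by (rule AE_not_in) (simp add: S(1) finite_imp_null_set_lborel null_sets_completionI)
  then have "AE t in lebesgue. \<exists>v\<in>direction_cone u (1 / L). (c has_vector_derivative v) (at t)"
    by eventually_elim (rule *)
  with lip show ?thesis
    by (auto simp: cone_curves_def)
qed

lemma emeasure_le_hausdorff1:
  fixes u :: "'a::euclidean_space"
  assumes cu: "\<And>s. c s \<bullet> u = s" and u: "norm u = 1"
  shows "emeasure lborel {s. c s \<in> G} \<le> hausdorff1 (G \<inter> range c)"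
proof -
  have "emeasure lborel {s. c s \<in> G} \<le> (\<Sum>i. ennreal (diameter (U i)))"
    if cover: "G \<inter> range c \<subseteq> (\<Union>i. U i)" and bd: "\<And>i. bounded (U i)" for U :: "nat \<Rightarrow> 'a set"
  proof -
    define J where "J i = (if U i = {} then {} else
        {Inf ((\<lambda>z. z \<bullet> u) ` U i) .. Inf ((\<lambda>z. z \<bullet> u) ` U i) + diameter (U i)})" for i
    have U_J: "z \<bullet> u \<in> J i" if z: "z \<in> U i" for z i
    proof -
      have near: "z \<bullet> u - w \<bullet> u \<le> diameter (U i)" if "w \<in> U i" for w
      proof -
        have "z \<bullet> u - w \<bullet> u \<le> norm (z - w) * norm u"
          by (metis inner_diff_left norm_cauchy_schwarz)
        also have "\<dots> = dist z w"
          by (simp add: u dist_norm)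
        also have "\<dots> \<le> diameter (U i)"
          using diameter_bounded_bound[OF bd z that] .
        finally show ?thesis .
      qed
      have "z \<bullet> u - diameter (U i) \<le> Inf ((\<lambda>z. z \<bullet> u) ` U i)"
        by (rule cInf_greatest) (use z near in \<open>auto simp: algebra_simps\<close>)
      moreover have "Inf ((\<lambda>z. z \<bullet> u) ` U i) \<le> z \<bullet> u"
      proof (rule cInf_lower)
        show "bdd_below ((\<lambda>z. z \<bullet> u) ` U i)"
          using near by (intro bdd_belowI2[where m = "z \<bullet> u - diameter (U i)"]) (auto simp: algebra_simps)
      qed (use z in auto)
      ultimately show ?thesis
        using z by (auto simp: J_def)
    qed
    have "{s. c s \<in> G} \<subseteq> (\<Union>i. J i)"
    proof
      fix s assume "s \<in> {s. c s \<in> G}"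
      then obtain i where "c s \<in> U i"
        using cover by blast
      from U_J[OF this] show "s \<in> (\<Union>i. J i)"
        by (auto simp: cu)
    qed
    moreover have J_sets: "J i \<in> sets lborel" for i
      by (simp add: J_def)
    ultimately have "emeasure lborel {s. c s \<in> G} \<le> emeasure lborel (\<Union>i. J i)"
      by (intro emeasure_mono) auto
    also have "\<dots> \<le> (\<Sum>i. emeasure lborel (J i))"
      using J_sets by (intro emeasure_subadditive_countably) auto
    also have "\<dots> \<le> (\<Sum>i. ennreal (diameter (U i)))"
      by (intro suminf_le) (auto simp: J_def diameter_ge_0 bd)
    finally show ?thesis .
  qed
  then have "emeasure lborel {s. c s \<in> G} \<le> hausdorff1_delta 1 (G \<inter> range c)"
    unfolding hausdorff1_delta_def by (intro INF_greatest) auto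
  also have "\<dots> \<le> hausdorff1 (G \<inter> range c)"
    unfolding hausdorff1_def by (intro SUP_upper) auto
  finally show ?thesis .
qed

lemma thin_of_width_eq_0:
  fixes u :: "'a::euclidean_space"
  assumes w: "width u (1 / L) E = 0" and u: "norm u = 1" and L: "L \<ge> 1"
  shows "thin u L E"
  unfolding thin_def
proof (intro allI impI)
  fix \<tau> :: real assume "\<tau> > 0"
  have "(INF G\<in>{G. open G \<and> E \<subseteq> G}. open_width u (1 / L) G) = 0"
    using w u L by (auto simp: width_def split: if_splits)
  also have "0 < ennreal \<tau>"
    using \<open>\<tau> > 0\<close> by simp
  finally obtain G where G: "open G" "E \<subseteq> G" "open_width u (1 / L) G < ennreal \<tau>"
    by (auto simp: INF_less_iff)
  have "emeasure lborel {s. c s \<in> G} \<le> ennreal \<tau>" if c: "steep_curve u L c" for c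
  proof -
    have "emeasure lborel {s. c s \<in> G} \<le> hausdorff1 (G \<inter> range c)"
      using c u by (intro emeasure_le_hausdorff1) (auto simp: steep_curve_def)
    also have "\<dots> \<le> open_width u (1 / L) G"
      unfolding open_width_def
      by (intro SUP_upper steep_curve_in_cone_curves c u L)
    also note G(3)
    finally show ?thesis by simp
  qed
  with G show "\<exists>G. open G \<and> E \<subseteq> G \<and>
      (\<forall>c. steep_curve u L c \<longrightarrow> emeasure lborel {s. c s \<in> G} \<le> ennreal \<tau>)"
    by blast
qed

lemma thin_subset: "thin u L E \<Longrightarrow> F \<subseteq> E \<Longrightarrow> thin u L F"
  unfolding thin_def by (meson order_trans)

lemma steep_curve_vimage_borel:
  assumes "steep_curve u L c" "open G"
  shows "{s. c s \<in> G} \<in> sets borel"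
proof -
  have "continuous_on UNIV c"
    using assms(1) by (auto simp: steep_curve_def intro: lipschitz_on_continuous_on)
  then have "open (c -` G)"
    using assms(2) by (simp add: open_vimage)
  then show ?thesis
    by (simp add: vimage_def)
qed

lemma suminf_ennreal_half_power:
  assumes "\<tau> \<ge> 0"
  shows "(\<Sum>i. ennreal (\<tau> * (1 / 2) ^ i)) = ennreal (2 * \<tau>)"
proof -
  have "(\<lambda>i. \<tau> * (1 / 2) ^ i) sums (\<tau> * (1 / (1 - 1 / 2)))"
    by (intro sums_mult geometric_sums) simp
  then have "(\<lambda>i. \<tau> * (1 / 2) ^ i) sums (2 * \<tau>)"
    by (simp add: mult.commute[of \<tau> 2])
  then show ?thesis
    using assms by (intro suminf_ennreal_eq) auto
qed

lemma thin_UN: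
  fixes F :: "nat \<Rightarrow> 'a::euclidean_space set"
  assumes "\<And>i. thin u L (F i)"
  shows "thin u L (\<Union>i. F i)"
  unfolding thin_def
proof (intro allI impI)
  fix \<tau> :: real assume "\<tau> > 0"
  have "\<exists>G. open G \<and> F i \<subseteq> G \<and> (\<forall>c. steep_curve u L c \<longrightarrow>
      emeasure lborel {s. c s \<in> G} \<le> ennreal (\<tau> / 2 * (1 / 2) ^ i))" for i
    using assms[of i] \<open>\<tau> > 0\<close> by (simp add: thin_def)
  then obtain G where G: "\<And>i. open (G i)" "\<And>i. F i \<subseteq> G i"
    "\<And>i c. steep_curve u L c \<Longrightarrow>
       emeasure lborel {s. c s \<in> G i} \<le> ennreal (\<tau> / 2 * (1 / 2) ^ i)"
    by metis
  have "emeasure lborel {s. c s \<in> (\<Union>i. G i)} \<le> ennreal \<tau>" if c: "steep_curve u L c" for c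
  proof -
    have "{s. c s \<in> (\<Union>i. G i)} = (\<Union>i. {s. c s \<in> G i})"
      by auto
    then have "emeasure lborel {s. c s \<in> (\<Union>i. G i)} \<le> (\<Sum>i. emeasure lborel {s. c s \<in> G i})"
      using steep_curve_vimage_borel[OF c G(1)]
      by (auto intro!: emeasure_subadditive_countably)
    also have "\<dots> \<le> (\<Sum>i. ennreal (\<tau> / 2 * (1 / 2) ^ i))"
      by (intro suminf_le G(3) c) auto
    also have "\<dots> = ennreal \<tau>"
      using \<open>\<tau> > 0\<close> by (subst suminf_ennreal_half_power) auto
    finally show ?thesis .
  qed
  with G show "\<exists>G. open G \<and> (\<Union>i. F i) \<subseteq> G \<and>
      (\<forall>c. steep_curve u L c \<longrightarrow> emeasure lborel {s. c s \<in> G} \<le> ennreal \<tau>)"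
    by (intro exI[of _ "\<Union>i. G i"]) blast
qed

lemma thin_of_uniformly_purely_unrectifiable:
  fixes E :: "'a::euclidean_space set"
  assumes E: "uniformly_purely_unrectifiable E" and u: "norm u = 1" and L: "L \<ge> 1"
  shows "thin u L E"
proof (cases "E = {}")
  case True
  then show ?thesis
    by (auto simp: thin_def intro!: exI[of _ "{}"])
next
  case False
  have "\<exists>r>0. width u (1 / L) (ball x r \<inter> E) = 0" if "x \<in> E" for x
  proof -
    have "u \<in> null_directions E x"
      using E that by (simp add: uniformly_purely_unrectifiable_def)
    then show ?thesis
      using L unfolding null_directions_def by simp
  qed
  then obtain r where r: "\<And>x. x \<in> E \<Longrightarrow> r x > 0 \<and> width u (1 / L) (ball x (r x) \<inter> E) = 0"
    by metis
  obtain B where B: "B \<subseteq> (\<lambda>x. ball x (r x)) ` E" "countable B" "\<Union>B = (\<Union>x\<in>E. ball x (r x))"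
    using Lindelof[of "(\<lambda>x. ball x (r x)) ` E"] by auto
  have "E \<subseteq> \<Union>B"
    using r B(3) by fastforce
  with False have "B \<noteq> {}"
    by auto
  then have range: "range (from_nat_into B) = B"
    using B(2) by (simp add: range_from_nat_into)
  have "thin u L (from_nat_into B i \<inter> E)" for i
  proof -
    have "from_nat_into B i \<in> B"
      using \<open>B \<noteq> {}\<close> by (rule from_nat_into)
    with B(1) obtain x where "x \<in> E" "from_nat_into B i = ball x (r x)"
      by auto
    with r show ?thesis
      by (auto intro: thin_of_width_eq_0 u L)
  qed
  then have "thin u L (\<Union>i. from_nat_into B i \<inter> E)"
    by (rule thin_UN)
  moreover have "E \<subseteq> (\<Union>i. from_nat_into B i \<inter> E)"
    using \<open>E \<subseteq> \<Union>B\<close> range by (metis UN_simps(4) Int_absorb1 Int_lower2 subset_refl)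
  ultimately show ?thesis
    by (rule thin_subset)
qed

lemma thin_weighted_cover:
  fixes u :: "'a::euclidean_space"
  assumes thin: "thin u L E" and L: "L \<ge> 1" and \<sigma>: "\<sigma> > 0"
    and \<omega>: "1-lipschitz_on UNIV \<omega>" "\<And>x. \<omega> x \<ge> 0" "\<And>x. x \<in> E \<Longrightarrow> \<omega> x > 0"
  obtains G where "open G" "E \<subseteq> G"
    "\<And>c a b x. steep_curve u L c \<Longrightarrow> a \<le> b \<Longrightarrow>
       measure lborel {s \<in> {a..b}. c s \<in> G} \<le> \<omega> x + \<sigma> * (b - a) + \<sigma> * norm (x - c b)"
proof -
  define \<tau> where "\<tau> = min (1 / 2) (\<sigma> / (2 * L))"
  have \<tau>: "\<tau> > 0" "2 * \<tau> \<le> 1" "2 * \<tau> * L \<le> \<sigma>"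
    using L \<sigma> by (auto simp: \<tau>_def min_def field_simps)
  define H where "H k = {x. \<omega> x > (1 / 2) ^ k}" for k :: nat
  have H: "open (H k)" for k
    unfolding H_def using lipschitz_on_continuous_on[OF \<omega>(1)]
    by (intro open_Collect_less continuous_intros) auto
  have "\<exists>G. open G \<and> E \<subseteq> G \<and> (\<forall>c. steep_curve u L c \<longrightarrow>
      emeasure lborel {s. c s \<in> G} \<le> ennreal (\<tau> * (1 / 4) ^ k))" for k
    using thin \<tau>(1) by (simp add: thin_def)
  then obtain U where U: "\<And>k. open (U k)" "\<And>k. E \<subseteq> U k"
    "\<And>k c. steep_curve u L c \<Longrightarrow> emeasure lborel {s. c s \<in> U k} \<le> ennreal (\<tau> * (1 / 4) ^ k)"
    by metis
  define G where "G = (\<Union>k. U k \<inter> H k)"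
  have UH: "open (U k \<inter> H k)" for k
    using U(1) H by auto
  show ?thesis
  proof (rule that)
    show "open G"
      unfolding G_def using UH by auto
    show "E \<subseteq> G"
    proof
      fix x assume "x \<in> E"
      with \<omega>(3) obtain k where "(1 / 2) ^ k < \<omega> x"
        using real_arch_pow_inv[of "\<omega> x" "1 / 2"] by auto
      then show "x \<in> G"
        using U(2) \<open>x \<in> E\<close> by (auto simp: G_def H_def)
    qed
    fix c :: "real \<Rightarrow> 'a" and a b :: real and x :: 'a
    assume c: "steep_curve u L c" and "a \<le> b"
    define Q where "Q = \<sigma> * (b - a) + \<sigma> * norm (x - c b)"
    define T where "T = \<omega> x + L / \<sigma> * Q"
    have "Q \<ge> 0"
      using \<sigma> \<open>a \<le> b\<close> by (simp add: Q_def)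
    then have "T \<ge> 0"
      using \<omega>(2) L \<sigma> by (simp add: T_def)
    have \<omega>_le: "\<omega> (c s) \<le> T" if "s \<in> {a..b}" for s
    proof -
      have "\<omega> (c s) - \<omega> x \<le> norm (c s - x)"
        using lipschitz_on_normD[OF \<omega>(1), of "c s" x] by simp
      also have "\<dots> \<le> norm (c s - c b) + norm (x - c b)"
        using norm_triangle_ineq[of "c s - c b" "c b - x"] by (simp add: norm_minus_commute)
      also have "norm (c s - c b) \<le> L * (b - s)"
        using c lipschitz_on_normD[of L UNIV c s b] that by (auto simp: steep_curve_def)
      also have "\<dots> \<le> L * (b - a)"
        using that L by simp
      also have "norm (x - c b) \<le> L * norm (x - c b)"
        using L mult_right_mono[OF L norm_ge_zero[of "x - c b"]] by simp
      also have "L * (b - a) + L * norm (x - c b) = L / \<sigma> * Q"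
        using \<sigma> by (simp add: Q_def field_simps)
      finally show ?thesis by (simp add: T_def)
    qed
    let ?A = "\<lambda>k. {s \<in> {a..b}. c s \<in> U k \<inter> H k}"
    have A_sets: "?A k \<in> sets lborel" for k
    proof -
      have "?A k = {a..b} \<inter> {s. c s \<in> U k \<inter> H k}"
        by auto
      then show ?thesis
        using steep_curve_vimage_borel[OF c UH] by simp
    qed
    \<comment> \<open>a piece \<open>k\<close> that the curve meets has level \<open>2\<^sup>-\<^sup>k \<le> T\<close>, so that one of the
      two factors \<open>2\<^sup>-\<^sup>k\<close> of its width can be traded for \<open>T\<close>\<close>
    have "emeasure lborel (?A k) \<le> ennreal (\<tau> * T * (1 / 2) ^ k)" for k
    proof (cases "?A k = {}")
      case True
      then show ?thesis by (simp only: emeasure_empty) simp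
    next
      case False
      then obtain s where "s \<in> {a..b}" "c s \<in> H k" by auto
      with \<omega>_le have "(1 / 2) ^ k \<le> T"
        by (force simp: H_def)
      then have "\<tau> * ((1 / 2) ^ k * (1 / 2) ^ k) \<le> \<tau> * (T * (1 / 2) ^ k)"
        using \<tau>(1) by (intro mult_left_mono mult_right_mono) auto
      then have le: "\<tau> * (1 / 4) ^ k \<le> \<tau> * T * (1 / 2) ^ k"
        by (simp add: power_mult_distrib[symmetric] mult.assoc)
      have "emeasure lborel (?A k) \<le> emeasure lborel {s. c s \<in> U k}"
        using steep_curve_vimage_borel[OF c U(1)] by (intro emeasure_mono) auto
      also note U(3)[OF c]
      also have "ennreal (\<tau> * (1 / 4) ^ k) \<le> ennreal (\<tau> * T * (1 / 2) ^ k)"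
        using le by (rule ennreal_leI)
      finally show ?thesis .
    qed
    moreover have "{s \<in> {a..b}. c s \<in> G} = (\<Union>k. ?A k)"
      by (auto simp: G_def)
    then have "emeasure lborel {s \<in> {a..b}. c s \<in> G} \<le> (\<Sum>k. emeasure lborel (?A k))"
      using A_sets by (simp only:) (intro emeasure_subadditive_countably, auto)
    ultimately have "emeasure lborel {s \<in> {a..b}. c s \<in> G} \<le> (\<Sum>k. ennreal (\<tau> * T * (1 / 2) ^ k))"
      by (meson order_trans suminf_le summableI)
    also have "\<dots> = ennreal (2 * (\<tau> * T))"
      using \<tau>(1) \<open>T \<ge> 0\<close> by (intro suminf_ennreal_half_power) simp
    finally have "measure lborel {s \<in> {a..b}. c s \<in> G} \<le> 2 * (\<tau> * T)"
      unfolding measure_def using \<tau>(1) \<open>T \<ge> 0\<close> by (intro enn2real_leI) auto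
    also have "\<dots> = 2 * \<tau> * \<omega> x + 2 * \<tau> * L / \<sigma> * Q"
      by (simp add: T_def algebra_simps)
    also have "\<dots> \<le> 1 * \<omega> x + 1 * Q"
      using \<tau> \<sigma> \<open>Q \<ge> 0\<close> \<omega>(2)[of x] by (intro add_mono mult_right_mono) (auto simp: field_simps)
    finally show "measure lborel {s \<in> {a..b}. c s \<in> G} \<le> \<omega> x + \<sigma> * (b - a) + \<sigma> * norm (x - c b)"
      by (simp add: Q_def)
  qed
qed

lemma steep_curve_line:
  fixes u :: "'a::euclidean_space"
  assumes "norm u = 1" "L \<ge> 1"
  shows "steep_curve u L (\<lambda>s. x + (s - x \<bullet> u) *\<^sub>R u)"
proof -
  have "L-lipschitz_on UNIV (\<lambda>s. x + (s - x \<bullet> u) *\<^sub>R u)"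
  proof (rule lipschitz_onI)
    fix s t :: real
    have "dist (x + (s - x \<bullet> u) *\<^sub>R u) (x + (t - x \<bullet> u) *\<^sub>R u) = norm ((s - t) *\<^sub>R u)"
      by (simp add: dist_norm algebra_simps)
    then show "dist (x + (s - x \<bullet> u) *\<^sub>R u) (x + (t - x \<bullet> u) *\<^sub>R u) \<le> L * dist s t"
      using assms mult_right_mono[of 1 L "\<bar>s - t\<bar>"] by (simp add: dist_norm)
  qed (use assms in auto)
  moreover have "u \<bullet> u = 1"
    using assms(1) by (simp add: norm_eq_1)
  ultimately show ?thesis
    unfolding steep_curve_def
    by (auto simp: inner_add_left intro!: exI[of _ "{}"] derivative_intros)
qed

lemma steep_curve_extend:
  fixes u :: "'a::euclidean_space"
  assumes c: "steep_curve u L c" and v: "0 < v \<bullet> u" "norm v \<le> L * (v \<bullet> u)"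
  obtains c' where "steep_curve u L c'" "\<And>s. s \<le> b \<Longrightarrow> c' s = c s"
    "\<And>t. t \<ge> 0 \<Longrightarrow> c' (b + t * (v \<bullet> u)) = c b + t *\<^sub>R v"
proof -
  from c have cu: "\<And>s. c s \<bullet> u = s" and lip: "L-lipschitz_on UNIV c"
    by (auto simp: steep_curve_def)
  from c obtain S where S: "finite S" "\<And>t. t \<notin> S \<Longrightarrow> c differentiable (at t)"
    by (auto simp: steep_curve_def)
  define l where "l s = c b + ((s - b) / (v \<bullet> u)) *\<^sub>R v" for s
  define c' where "c' s = (if s \<le> b then c s else l s)" for s
  have l_eq: "norm (l s - l t) \<le> L * \<bar>s - t\<bar>" for s t
  proof -
    have "l s - l t = ((s - t) / (v \<bullet> u)) *\<^sub>R v"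
      by (simp add: l_def algebra_simps diff_divide_distrib)
    then have "norm (l s - l t) = \<bar>s - t\<bar> / (v \<bullet> u) * norm v"
      using v(1) by simp
    also have "\<dots> \<le> \<bar>s - t\<bar> / (v \<bullet> u) * (L * (v \<bullet> u))"
      using v by (intro mult_left_mono) auto
    also have "\<dots> = L * \<bar>s - t\<bar>"
      using v(1) by simp
    finally show ?thesis .
  qed
  have c'_le: "norm (c' s - c' t) \<le> L * (t - s)" if "s \<le> t" for s t
  proof -
    consider "t \<le> b" | "b < s" | "s \<le> b" "b < t" using that by linarith
    then show ?thesis
    proof cases
      case 1
      then show ?thesis
        using lipschitz_on_normD[OF lip, of s t] that by (simp add: c'_def)
    next
      case 2
      then show ?thesis
        using l_eq[of s t] that by (simp add: c'_def)
    next
      case 3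
      have "norm (c' s - c' t) \<le> norm (c s - c b) + norm (l b - l t)"
        using 3 norm_triangle_ineq[of "c s - c b" "l b - l t"]
        by (simp add: c'_def l_def diff_diff_eq)
      also have "\<dots> \<le> L * (b - s) + L * (t - b)"
        using lipschitz_on_normD[OF lip, of s b] l_eq[of b t] 3 by (intro add_mono) auto
      finally show ?thesis by (simp add: algebra_simps)
    qed
  qed
  have "L-lipschitz_on UNIV c'"
    using c'_le by (intro lipschitz_on_leI lipschitz_on_nonneg[OF lip])
      (auto simp: dist_norm)
  moreover have "c' s \<bullet> u = s" for s
    using v(1) by (simp add: c'_def l_def cu inner_add_left)
  moreover have "c' differentiable (at t)" if "t \<notin> insert b S" for t
  proof (cases "t < b")
    case True
    have "c differentiable (at t)"
      using S(2) that by simp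
    then obtain D where "(c has_derivative D) (at t)"
      by (auto simp: differentiable_def)
    then have "(c' has_derivative D) (at t)"
      by (rule has_derivative_transform_within_open[of _ _ _ _ "{..<b}"])
        (use True in \<open>auto simp: c'_def\<close>)
    then show ?thesis
      by (auto simp: differentiable_def)
  next
    case False
    have "(l has_derivative (\<lambda>h. (h / (v \<bullet> u)) *\<^sub>R v)) (at t)"
      unfolding l_def using v(1) by (auto intro!: derivative_eq_intros)
    then have "(c' has_derivative (\<lambda>h. (h / (v \<bullet> u)) *\<^sub>R v)) (at t)"
      by (rule has_derivative_transform_within_open[of _ _ _ _ "{b<..}"])
        (use False that in \<open>auto simp: c'_def\<close>)
    then show ?thesis
      by (auto simp: differentiable_def)
  qed
  ultimately have "steep_curve u L c'"
    using S(1) by (auto simp: steep_curve_def intro!: exI[of _ "insert b S"])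
  moreover have "c' (b + t * (v \<bullet> u)) = c b + t *\<^sub>R v" if "t \<ge> 0" for t
    using that v(1) by (cases "t = 0") (auto simp: c'_def l_def mult_le_0_iff)
  ultimately show ?thesis
    using that[of c'] by (simp add: c'_def)
qed

text \<open>
  The first term is the height by which a curve of slope \<open>M\<close> that starts at distance \<open>v\<close>
  from a path of slope \<open>L\<close> trails before it catches up with the path.
\<close>

definition jump_cost :: "'a::euclidean_space \<Rightarrow> real \<Rightarrow> real \<Rightarrow> real \<Rightarrow> 'a \<Rightarrow> real" where
  "jump_cost u L M \<sigma> v = max 0 ((norm v - M * (v \<bullet> u)) / (M - L)) + \<sigma> * norm v"

lemma jump_cost_add:
  assumes "L < M" "\<sigma> > 0"
  shows "jump_cost u L M \<sigma> (v + w) \<le> jump_cost u L M \<sigma> v + jump_cost u L M \<sigma> w"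
proof -
  have "(norm (v + w) - M * ((v + w) \<bullet> u)) / (M - L)
      \<le> (norm v - M * (v \<bullet> u) + (norm w - M * (w \<bullet> u))) / (M - L)"
    using assms norm_triangle_ineq[of v w]
    by (intro divide_right_mono) (auto simp: inner_add_left algebra_simps)
  moreover have "\<sigma> * norm (v + w) \<le> \<sigma> * norm v + \<sigma> * norm w"
    using assms norm_triangle_ineq[of v w] by (simp add: distrib_left[symmetric])
  ultimately show ?thesis
    unfolding jump_cost_def add_divide_distrib by linarith
qed

lemma width_potential:
  fixes u :: "'a::euclidean_space"
  assumes u: "norm u = 1" and LM: "1 \<le> L" "L < M" and \<sigma>: "\<sigma> > 0" and G: "open G"
    and small: "\<And>c a b x. steep_curve u M c \<Longrightarrow> a \<le> b \<Longrightarrow>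
       measure lborel {s \<in> {a..b}. c s \<in> G} \<le> \<omega> x + \<sigma> * (b - a) + \<sigma> * norm (x - c b)"
  obtains \<phi> where "\<And>x. 0 \<le> \<phi> x" "\<And>x. \<phi> x \<le> \<omega> x"
    "\<And>x v. \<phi> (x + v) \<ge> \<phi> x - jump_cost u L M \<sigma> v"
    "\<And>x v. closed_segment x (x + v) \<subseteq> G \<Longrightarrow> norm v \<le> L * (v \<bullet> u) \<Longrightarrow>
       \<phi> (x + v) \<ge> \<phi> x + v \<bullet> u - \<sigma> * norm v"
proof -
  let ?J = "jump_cost u L M \<sigma>"
  define gain where "gain c a b = measure lborel {s \<in> {a..b}. c s \<in> G} - \<sigma> * (b - a)"
    for c :: "real \<Rightarrow> 'a" and a b
  define V where "V x = {gain c a b - ?J (x - c b) | c a b. steep_curve u M c \<and> a \<le> b}" for x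
  define \<phi> where "\<phi> x = Sup (V x)" for x
  have M: "M \<ge> 1"
    using LM by simp
  have J_ge: "?J v \<ge> \<sigma> * norm v" for v
    by (simp add: jump_cost_def)
  have V_le: "y \<le> \<omega> x" if "y \<in> V x" for x y
  proof -
    from that obtain c a b where "steep_curve u M c" "a \<le> b" "y = gain c a b - ?J (x - c b)"
      by (auto simp: V_def)
    with small[of c a b x] J_ge[of "x - c b"] show ?thesis
      by (simp add: gain_def)
  qed
  have V_bdd: "bdd_above (V x)" for x
    using V_le by (rule bdd_aboveI)
  have V_0: "0 \<in> V x" for x
  proof -
    let ?c = "\<lambda>s. x + (s - x \<bullet> u) *\<^sub>R u"
    have "{s \<in> {x \<bullet> u..x \<bullet> u}. ?c s \<in> G} \<subseteq> {x \<bullet> u}"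
      by auto
    then have "measure lborel {s \<in> {x \<bullet> u..x \<bullet> u}. ?c s \<in> G} = 0"
      by (intro measure_eq_0_null_sets finite_imp_null_set_lborel)
        (rule finite_subset, auto)
    then have "gain ?c (x \<bullet> u) (x \<bullet> u) - ?J (x - ?c (x \<bullet> u)) = 0"
      by (simp add: gain_def jump_cost_def)
    then show ?thesis
      unfolding V_def using steep_curve_line[OF u M, of x]
      by (intro CollectI exI[of _ ?c] exI[of _ "x \<bullet> u"]) auto
  qed
  have \<phi>_ge: "y \<le> \<phi> x" if "y \<in> V x" for x y
    unfolding \<phi>_def using that V_bdd by (rule cSup_upper)
  have \<phi>_le: "\<phi> x \<le> k" if "\<And>c a b. steep_curve u M c \<Longrightarrow> a \<le> b \<Longrightarrow> gain c a b - ?J (x - c b) \<le> k"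
    for x k
    unfolding \<phi>_def using V_0[of x] by (intro cSup_least) (use that in \<open>auto simp: V_def\<close>)
  show ?thesis
  proof (rule that)
    fix x
    show "0 \<le> \<phi> x"
      using V_0 by (rule \<phi>_ge)
    show "\<phi> x \<le> \<omega> x"
      unfolding \<phi>_def using V_0[of x] V_le by (intro cSup_least) auto
  next
    fix x v
    have "\<phi> x \<le> \<phi> (x + v) + ?J v"
    proof (rule \<phi>_le)
      fix c :: "real \<Rightarrow> 'a" and a b :: real assume c: "steep_curve u M c" "a \<le> b"
      then have "gain c a b - ?J (x + v - c b) \<le> \<phi> (x + v)"
        by (intro \<phi>_ge) (auto simp: V_def)
      moreover have "?J (x + v - c b) \<le> ?J (x - c b) + ?J v"
        using jump_cost_add[OF LM(2) \<sigma>, of u "x - c b" v] by (simp add: algebra_simps)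
      ultimately show "gain c a b - ?J (x - c b) \<le> \<phi> (x + v) + ?J v"
        by simp
    qed
    then show "\<phi> (x + v) \<ge> \<phi> x - ?J v"
      by simp
  next
    fix x v
    assume seg: "closed_segment x (x + v) \<subseteq> G" and v: "norm v \<le> L * (v \<bullet> u)"
    have vu: "v \<bullet> u \<ge> 0"
      using v LM norm_ge_zero[of v] by (smt (verit) mult_nonneg_nonpos mult_less_0_iff)
    have "\<phi> x \<le> \<phi> (x + v) - (v \<bullet> u - \<sigma> * norm v)"
    proof (rule \<phi>_le)
      fix c :: "real \<Rightarrow> 'a" and a b :: real assume c: "steep_curve u M c" and ab: "a \<le> b"
      define w where "w = x - c b"
      define j where "j = max 0 ((norm w - M * (w \<bullet> u)) / (M - L))"
      have J_w: "?J w = j + \<sigma> * norm w"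
        by (simp add: jump_cost_def j_def)
      have j: "j \<ge> 0" "norm w - M * (w \<bullet> u) \<le> (M - L) * j"
        using LM by (auto simp: j_def max_def field_simps)
      show "gain c a b - ?J (x - c b) \<le> \<phi> (x + v) - (v \<bullet> u - \<sigma> * norm v)"
      proof (cases "v \<bullet> u \<le> j")
        case True
        have "norm (w + v) - M * ((w + v) \<bullet> u) \<le> norm w - M * (w \<bullet> u) - (M - L) * (v \<bullet> u)"
          using norm_triangle_ineq[of w v] v by (simp add: inner_add_left algebra_simps)
        also have "\<dots> \<le> (M - L) * (j - v \<bullet> u)"
          using j(2) by (simp add: right_diff_distrib)
        finally have "(norm (w + v) - M * ((w + v) \<bullet> u)) / (M - L) \<le> j - v \<bullet> u"
          using LM by (simp add: field_simps)
        moreover have "\<sigma> * norm (w + v) \<le> \<sigma> * norm w + \<sigma> * norm v"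
          using \<sigma> norm_triangle_ineq[of w v] by (simp add: distrib_left[symmetric])
        ultimately have "?J (w + v) \<le> ?J w - v \<bullet> u + \<sigma> * norm v"
          using True unfolding J_w by (simp add: jump_cost_def)
        moreover have "gain c a b - ?J (w + v) \<le> \<phi> (x + v)"
          using c ab by (intro \<phi>_ge) (force simp: V_def w_def algebra_simps)
        ultimately show ?thesis
          by (simp add: w_def)
      next
        case False
        \<comment> \<open>the curve is first continued to the point \<open>x + \<theta> v\<close>, the nearest one of the
          segment known to be within reach, and then along \<open>v\<close>\<close>
        define \<theta> where "\<theta> = j / (v \<bullet> u)"
        have vu': "v \<bullet> u > 0"
          using False j by simp
        have \<theta>: "0 \<le> \<theta>" "\<theta> < 1" "\<theta> * (v \<bullet> u) = j"
          using False j vu' by (auto simp: \<theta>_def)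
        define z where "z = w + \<theta> *\<^sub>R v"
        have z_norm: "norm z \<le> M * (z \<bullet> u)"
        proof -
          have "\<theta> * norm v \<le> \<theta> * (L * (v \<bullet> u))"
            using v \<theta>(1) by (rule mult_left_mono)
          also have "\<dots> = L * j"
            using \<theta>(3) by (simp add: mult_ac)
          finally have "norm z \<le> norm w + L * j"
            using norm_triangle_ineq[of w "\<theta> *\<^sub>R v"] \<theta>(1) by (simp add: z_def)
          also have "\<dots> \<le> M * (w \<bullet> u) + M * j"
            using j(2) by (simp add: algebra_simps)
          also have "\<dots> = M * (z \<bullet> u)"
            by (simp add: z_def inner_add_left distrib_left \<theta>(3))
          finally show ?thesis .
        qed
        obtain c1 where c1: "steep_curve u M c1" "\<And>s. s \<le> b \<Longrightarrow> c1 s = c s"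
          "c1 (b + z \<bullet> u) = x + \<theta> *\<^sub>R v" and zu: "z \<bullet> u \<ge> 0"
        proof (cases "z = 0")
          case True
          then show ?thesis
            using that[of c] c by (simp add: z_def w_def algebra_simps)
        next
          case False
          then have "z \<bullet> u > 0"
            using z_norm M by (smt (verit) mult_nonneg_nonpos zero_less_norm_iff)
          then obtain c1 where c1: "steep_curve u M c1" "\<And>s. s \<le> b \<Longrightarrow> c1 s = c s"
            "\<And>t. t \<ge> 0 \<Longrightarrow> c1 (b + t * (z \<bullet> u)) = c b + t *\<^sub>R z"
            using steep_curve_extend[OF c _ z_norm] by blast
          with \<open>z \<bullet> u > 0\<close> show ?thesis
            using that[of c1] c1(1,2) c1(3)[of 1] by (simp add: z_def w_def)
        qed
        have "norm v \<le> M * (v \<bullet> u)"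
          using v LM vu by (meson mult_right_mono order_trans less_imp_le)
        then obtain c2 where c2: "steep_curve u M c2" "\<And>s. s \<le> b + z \<bullet> u \<Longrightarrow> c2 s = c1 s"
          "\<And>t. t \<ge> 0 \<Longrightarrow> c2 (b + z \<bullet> u + t * (v \<bullet> u)) = c1 (b + z \<bullet> u) + t *\<^sub>R v"
          using steep_curve_extend[OF c1(1) vu'] by blast
        define b1 where "b1 = b + z \<bullet> u"
        define b2 where "b2 = b1 + (1 - \<theta>) * (v \<bullet> u)"
        have b12: "b \<le> b1" "b1 \<le> b2"
          using zu \<theta>(2) vu by (auto simp: b1_def b2_def)
        have c2_seg: "c2 (b1 + t * (v \<bullet> u)) = x + (\<theta> + t) *\<^sub>R v" if "t \<ge> 0" for t
          using c2(3)[OF that] c1(3) by (simp add: b1_def scaleR_add_left)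
        have c2_b2: "c2 b2 = x + v"
          using c2_seg[of "1 - \<theta>"] \<theta>(2) by (simp add: b2_def)
        have in_G: "c2 s \<in> G" if "b1 \<le> s" "s \<le> b2" for s
        proof -
          define t where "t = (s - b1) / (v \<bullet> u)"
          have t: "0 \<le> t" "t \<le> 1 - \<theta>" "s = b1 + t * (v \<bullet> u)"
            using that vu' by (auto simp: t_def b2_def field_simps)
          then have "c2 s = x + (\<theta> + t) *\<^sub>R v"
            using c2_seg by simp
          also have "\<dots> = (1 - (\<theta> + t)) *\<^sub>R x + (\<theta> + t) *\<^sub>R (x + v)"
            by (simp add: algebra_simps)
          also have "\<dots> \<in> closed_segment x (x + v)"
            using t \<theta>(1) unfolding closed_segment_def by fastforce
          finally show ?thesis using seg by blast
        qed
        have sets: "{s \<in> {p..q}. c' s \<in> G} \<in> sets lborel" if "steep_curve u M c'" for c' p q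
        proof -
          have "{s \<in> {p..q}. c' s \<in> G} = {p..q} \<inter> {s. c' s \<in> G}"
            by auto
          then show ?thesis
            using steep_curve_vimage_borel[OF that G] by simp
        qed
        have fin: "emeasure lborel {s \<in> {p..q}. c' s \<in> G} \<noteq> \<infinity>" if "p \<le> q" for c' :: "real \<Rightarrow> 'a" and p q
        proof -
          have "emeasure lborel {s \<in> {p..q}. c' s \<in> G} \<le> emeasure lborel {p..q}"
            by (intro emeasure_mono) auto
          also have "\<dots> < \<infinity>"
            using that by simp
          finally show ?thesis by simp
        qed
        have "measure lborel {s \<in> {a..b}. c s \<in> G} + (1 - \<theta>) * (v \<bullet> u)
            = measure lborel {s \<in> {a..b}. c s \<in> G} + measure lborel {b1<..b2}"
          using b12 by (simp add: b2_def)
        also have "\<dots> = measure lborel ({s \<in> {a..b}. c s \<in> G} \<union> {b1<..b2})"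
          using b12 fin[OF ab] sets[OF c] by (intro measure_Union[symmetric]) auto
        also have "\<dots> \<le> measure lborel {s \<in> {a..b2}. c2 s \<in> G}"
        proof (rule measure_mono_fmeasurable)
          show "{s \<in> {a..b}. c s \<in> G} \<union> {b1<..b2} \<subseteq> {s \<in> {a..b2}. c2 s \<in> G}"
            using b12 ab c1(2) c2(2) in_G by (auto simp: b1_def)
          show "{s \<in> {a..b}. c s \<in> G} \<union> {b1<..b2} \<in> sets lborel"
            using sets[OF c] by auto
          show "{s \<in> {a..b2}. c2 s \<in> G} \<in> fmeasurable lborel"
            using sets[OF c2(1)] fin[of a b2 c2] ab b12 by (intro fmeasurableI) (auto simp: less_top)
        qed
        finally have "gain c a b + (1 - \<theta>) * (v \<bullet> u) - \<sigma> * (b2 - b) \<le> gain c2 a b2"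
          by (simp add: gain_def algebra_simps)
        moreover have "gain c2 a b2 - ?J (x + v - c2 b2) \<in> V (x + v)"
          using c2(1) ab b12 unfolding V_def by force
        then have "gain c2 a b2 \<le> \<phi> (x + v)"
          using \<phi>_ge[of _ "x + v"] by (force simp: c2_b2 jump_cost_def)
        moreover have "\<sigma> * (b2 - b) \<le> \<sigma> * norm w + \<sigma> * norm v"
        proof -
          have "b2 - b = w \<bullet> u + v \<bullet> u"
            by (simp add: b2_def b1_def z_def inner_add_left algebra_simps)
          also have "\<dots> \<le> norm w + norm v"
            using norm_cauchy_schwarz[of w u] norm_cauchy_schwarz[of v u] u by simp
          finally show ?thesis
            using \<sigma> by (simp add: distrib_left[symmetric])
        qed
        moreover have "(1 - \<theta>) * (v \<bullet> u) = v \<bullet> u - j"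
          by (simp add: left_diff_distrib \<theta>(3))
        ultimately have "gain c a b - (j + \<sigma> * norm w) \<le> \<phi> (x + v) - (v \<bullet> u - \<sigma> * norm v)"
          by linarith
        then show ?thesis
          using J_w by (simp add: w_def)
      qed
    qed
    then show "\<phi> (x + v) \<ge> \<phi> x + v \<bullet> u - \<sigma> * norm v"
      by simp
  qed
qed

definition uniformly_thin :: "'a::euclidean_space set \<Rightarrow> bool" where
  "uniformly_thin E \<longleftrightarrow> (\<forall>u L. norm u = 1 \<longrightarrow> L \<ge> 1 \<longrightarrow> thin u L E)"

lemma unit_direction_potential:
  fixes u :: "'a::euclidean_space"
  assumes E: "uniformly_thin E" and u: "norm u = 1" and \<epsilon>: "\<epsilon> > 0"
    and \<omega>: "1-lipschitz_on UNIV \<omega>" "\<And>x. \<omega> x \<ge> 0" "\<And>x. x \<in> E \<Longrightarrow> \<omega> x > 0"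
  obtains G \<phi> where "open G" "E \<subseteq> G" "\<And>x. 0 \<le> \<phi> x" "\<And>x. \<phi> x \<le> \<omega> x"
    "\<And>x v. \<phi> (x + v) \<ge> \<phi> x + min 0 (v \<bullet> u) - \<epsilon> * norm v"
    "\<And>x v. closed_segment x (x + v) \<subseteq> G \<Longrightarrow> \<phi> (x + v) \<ge> \<phi> x + v \<bullet> u - \<epsilon> * norm v"
proof -
  define L where "L = 1 + 3 / \<epsilon>"
  define M where "M = L + (1 + L) * (3 / \<epsilon>)"
  define \<sigma> where "\<sigma> = \<epsilon> / 3"
  have L: "L \<ge> 1" "1 / L \<le> \<epsilon> / 3"
    using \<epsilon> by (auto simp: L_def field_simps)
  have LM: "L < M"
    using L(1) \<epsilon> by (simp add: M_def)
  have "(1 + L) / ((1 + L) * (3 / \<epsilon>)) = 1 / (3 / \<epsilon>)"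
    using L(1) by (intro nonzero_divide_mult_cancel_left) simp
  moreover have "M - L = (1 + L) * (3 / \<epsilon>)"
    by (simp add: M_def)
  ultimately have ratio: "(1 + L) / (M - L) = \<epsilon> / 3"
    by (metis divide_divide_eq_right mult_1)
  have \<sigma>: "\<sigma> > 0"
    using \<epsilon> by (simp add: \<sigma>_def)
  have M: "M \<ge> 1"
    using L LM by simp
  have thin: "thin u M E"
    using E u M by (simp add: uniformly_thin_def)
  obtain G where G: "open G" "E \<subseteq> G" "\<And>c a b x. steep_curve u M c \<Longrightarrow> a \<le> b \<Longrightarrow>
       measure lborel {s \<in> {a..b}. c s \<in> G} \<le> \<omega> x + \<sigma> * (b - a) + \<sigma> * norm (x - c b)"
    using thin_weighted_cover[OF thin M \<sigma> \<omega>] by blast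
  obtain \<phi> where \<phi>: "\<And>x. 0 \<le> \<phi> x" "\<And>x. \<phi> x \<le> \<omega> x"
    "\<And>x v. \<phi> (x + v) \<ge> \<phi> x - jump_cost u L M \<sigma> v"
    "\<And>x v. closed_segment x (x + v) \<subseteq> G \<Longrightarrow> norm v \<le> L * (v \<bullet> u) \<Longrightarrow>
       \<phi> (x + v) \<ge> \<phi> x + v \<bullet> u - \<sigma> * norm v"
    using width_potential[OF u L(1) LM \<sigma> G(1,3)] by blast
  have nonneg: "\<epsilon> * norm v \<ge> 0" for v :: 'a
    using \<epsilon> by simp
  have J_le: "jump_cost u L M \<sigma> v \<le> - min 0 (v \<bullet> u) + 2 / 3 * \<epsilon> * norm v" for v
  proof -
    define p where "p = min 0 (v \<bullet> u)"
    have p: "p \<le> 0" "p \<le> v \<bullet> u" "- p \<le> norm v"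
      using Cauchy_Schwarz_ineq2[of v u] u by (auto simp: p_def)
    have "norm v - M * (v \<bullet> u) \<le> norm v + L * (- p) + (M - L) * (- p)"
      using p(2) M mult_left_mono[of p "v \<bullet> u" M] by (simp add: algebra_simps)
    also have "L * (- p) \<le> L * norm v"
      using p(3) L(1) by (intro mult_left_mono) auto
    finally have "norm v - M * (v \<bullet> u) \<le> (1 + L) * norm v + (M - L) * (- p)"
      by (simp add: algebra_simps)
    then have "(norm v - M * (v \<bullet> u)) / (M - L) \<le> ((1 + L) * norm v + (M - L) * (- p)) / (M - L)"
      using LM by (intro divide_right_mono) auto
    also have "\<dots> = (1 + L) / (M - L) * norm v - p"
      using LM by (simp add: field_simps)
    also have "\<dots> = \<epsilon> / 3 * norm v - p"
      by (simp only: ratio)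
    finally have "max 0 ((norm v - M * (v \<bullet> u)) / (M - L)) \<le> \<epsilon> / 3 * norm v - p"
      using p(1) nonneg[of v] by linarith
    then show ?thesis
      unfolding jump_cost_def \<sigma>_def p_def by linarith
  qed
  have weak: "\<phi> (x + v) \<ge> \<phi> x + min 0 (v \<bullet> u) - 2 / 3 * \<epsilon> * norm v" for x v
    using \<phi>(3)[of x v] J_le[of v] by simp
  show ?thesis
  proof (rule that[OF G(1,2) \<phi>(1,2)])
    fix x v
    show "\<phi> (x + v) \<ge> \<phi> x + min 0 (v \<bullet> u) - \<epsilon> * norm v"
      using weak[of x v] nonneg[of v] by simp
    assume seg: "closed_segment x (x + v) \<subseteq> G"
    show "\<phi> (x + v) \<ge> \<phi> x + v \<bullet> u - \<epsilon> * norm v"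
    proof (cases "norm v \<le> L * (v \<bullet> u)")
      case True
      then show ?thesis
        using \<phi>(4)[OF seg True] nonneg[of v] by (simp add: \<sigma>_def)
    next
      case False
      then have "v \<bullet> u \<le> 1 / L * norm v"
        using L(1) by (simp add: field_simps)
      also have "\<dots> \<le> \<epsilon> / 3 * norm v"
        using L(2) by (rule mult_right_mono) simp
      finally show ?thesis
        using weak[of x v] nonneg[of v] by (simp add: min_def split: if_splits)
    qed
  qed
qed

lemma direction_potential:
  fixes d :: "'a::euclidean_space"
  assumes E: "uniformly_thin E" and \<epsilon>: "\<epsilon> > 0"
    and \<omega>: "1-lipschitz_on UNIV \<omega>" "\<And>x. \<omega> x \<ge> 0" "\<And>x. x \<in> E \<Longrightarrow> \<omega> x > 0"
  obtains G \<phi> where "open G" "E \<subseteq> G" "\<And>x. 0 \<le> \<phi> x" "\<And>x. \<phi> x \<le> \<omega> x"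
    "\<And>x v. \<phi> (x + v) \<ge> \<phi> x + min 0 (d \<bullet> v) - \<epsilon> * norm v"
    "\<And>x v. closed_segment x (x + v) \<subseteq> G \<Longrightarrow> \<phi> (x + v) \<ge> \<phi> x + d \<bullet> v - \<epsilon> * norm v"
proof (cases "d = 0")
  case True
  show ?thesis
    by (rule that[of UNIV "\<lambda>_. 0"]) (use \<epsilon> \<omega> True in auto)
next
  case False
  define u where "u = d /\<^sub>R norm d"
  have u: "norm u = 1" and d: "d = norm d *\<^sub>R u"
    using False by (auto simp: u_def)
  define k where "k = max 1 (norm d)"
  have k: "k \<ge> 1" "norm d \<le> k"
    by (auto simp: k_def)
  have \<omega>': "1-lipschitz_on UNIV (\<lambda>x. \<omega> x / k)"
  proof (rule lipschitz_onI)
    fix x y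
    have "\<bar>\<omega> x - \<omega> y\<bar> / k \<le> \<bar>\<omega> x - \<omega> y\<bar>"
      using k by (simp add: divide_le_eq mult_le_cancel_left1)
    also have "\<dots> \<le> dist x y"
      using lipschitz_on_normD[OF \<omega>(1), of x y] by (simp add: dist_norm)
    finally show "dist (\<omega> x / k) (\<omega> y / k) \<le> 1 * dist x y"
      using k by (simp add: dist_real_def diff_divide_distrib[symmetric])
  qed simp
  have \<omega>'_pos: "\<omega> x / k \<ge> 0" "x \<in> E \<Longrightarrow> \<omega> x / k > 0" for x
    using \<omega>(2,3) k by (auto intro: divide_nonneg_nonneg divide_pos_pos)
  have \<epsilon>': "\<epsilon> / norm d > 0"
    using \<epsilon> False by simp
  obtain G \<phi> where G: "open G" "E \<subseteq> G" and \<phi>: "\<And>x. 0 \<le> \<phi> x" "\<And>x. \<phi> x \<le> \<omega> x / k"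
    "\<And>x v. \<phi> (x + v) \<ge> \<phi> x + min 0 (v \<bullet> u) - \<epsilon> / norm d * norm v"
    "\<And>x v. closed_segment x (x + v) \<subseteq> G \<Longrightarrow> \<phi> (x + v) \<ge> \<phi> x + v \<bullet> u - \<epsilon> / norm d * norm v"
    using unit_direction_potential[OF E u \<epsilon>' \<omega>' \<omega>'_pos] by blast
  have scale: "norm d * \<phi> (x + v) \<ge> norm d * \<phi> x + norm d * t - \<epsilon> * norm v"
    if "\<phi> (x + v) \<ge> \<phi> x + t - \<epsilon> / norm d * norm v" for x v t
    using mult_left_mono[OF that, of "norm d"] False by (simp add: algebra_simps)
  have du: "norm d * (v \<bullet> u) = d \<bullet> v" for v
    by (subst (2) d) (simp add: inner_commute)
  show ?thesis
  proof (rule that[of G "\<lambda>x. norm d * \<phi> x"])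
    fix x v
    show "norm d * \<phi> x \<ge> 0"
      using \<phi>(1) by simp
    have "norm d * \<phi> x \<le> k * (\<omega> x / k)"
      using k \<phi>(1,2) by (intro mult_mono) auto
    then show "norm d * \<phi> x \<le> \<omega> x"
      using k by simp
    have "norm d * min 0 (v \<bullet> u) = min 0 (d \<bullet> v)"
      using False by (auto simp: du[symmetric] min_def mult_le_0_iff zero_le_mult_iff)
    then show "norm d * \<phi> (x + v) \<ge> norm d * \<phi> x + min 0 (d \<bullet> v) - \<epsilon> * norm v"
      using scale[OF \<phi>(3)[of x v]] by simp
    show "norm d * \<phi> (x + v) \<ge> norm d * \<phi> x + d \<bullet> v - \<epsilon> * norm v"
      if "closed_segment x (x + v) \<subseteq> G"
      using scale[OF \<phi>(4)[OF that]] by (simp add: du)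
  qed (use G in auto)
qed

lemma finite_directions_below_cone:
  assumes "0 \<le> \<Lambda>" "\<Lambda> < \<Lambda>'"
  obtains A :: "'a::euclidean_space set" where "finite A" "A \<noteq> {}" "\<And>a. a \<in> A \<Longrightarrow> norm a \<le> \<Lambda>'"
    "\<And>w. \<exists>a\<in>A. a \<bullet> w \<le> - \<Lambda> * norm w"
proof -
  define \<eta> where "\<eta> = 1 - \<Lambda> / \<Lambda>'"
  have \<eta>: "\<eta> > 0" "\<Lambda>' * (1 - \<eta>) = \<Lambda>"
    using assms by (auto simp: \<eta>_def field_simps)
  have "sphere (0::'a) 1 \<subseteq> (\<Union>z\<in>sphere 0 1. ball z \<eta>)"
    using \<eta>(1) by (auto intro: bexI)
  then obtain F where F: "F \<subseteq> sphere (0::'a) 1" "finite F" "sphere 0 1 \<subseteq> (\<Union>z\<in>F. ball z \<eta>)"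
    using compactE_image[OF compact_sphere[of "0::'a" 1], of "sphere 0 1" "\<lambda>z. ball z \<eta>"]
    by (metis open_ball)
  have below: "\<exists>z\<in>F. (- \<Lambda>' *\<^sub>R z) \<bullet> w \<le> - \<Lambda> * norm w" if "w \<noteq> 0" for w :: 'a
  proof -
    define y where "y = w /\<^sub>R norm w"
    have y: "norm y = 1" "w = norm w *\<^sub>R y"
      using that by (auto simp: y_def)
    then obtain z where z: "z \<in> F" "dist z y < \<eta>"
      using F(3) by force
    have "(y - z) \<bullet> y \<le> norm (y - z) * norm y"
      by (rule norm_cauchy_schwarz)
    also have "\<dots> \<le> \<eta>"
      using z(2) y(1) by (simp add: dist_norm norm_minus_commute)
    finally have "1 - \<eta> \<le> z \<bullet> y"
      using y(1) by (simp add: inner_diff_left norm_eq_1)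
    then have "\<Lambda>' * (1 - \<eta>) * norm w \<le> \<Lambda>' * (z \<bullet> y) * norm w"
      using assms by (intro mult_left_mono mult_right_mono) auto
    also have "\<dots> = \<Lambda>' * (z \<bullet> w)"
      by (subst (2) y(2)) simp
    finally show ?thesis
      using z(1) \<eta>(2) by (intro bexI[of _ z]) auto
  qed
  show ?thesis
  proof (rule that[of "insert 0 ((\<lambda>z. - \<Lambda>' *\<^sub>R z) ` F)"])
    show "\<exists>a\<in>insert 0 ((\<lambda>z. - \<Lambda>' *\<^sub>R z) ` F). a \<bullet> w \<le> - \<Lambda> * norm w" for w :: 'a
      using below[of w] by (cases "w = 0") auto
  qed (use F assms in auto)
qed

lemma prescribe_gradient:
  fixes f :: "'a::euclidean_space \<Rightarrow> real"
  assumes E: "uniformly_thin E" and f: "\<Lambda>-lipschitz_on UNIV f" and e: "norm e \<le> \<Lambda>" and \<Lambda>: "\<Lambda> < \<Lambda>'" and \<epsilon>: "\<epsilon> > 0"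
    and \<omega>: "1-lipschitz_on UNIV \<omega>" "\<And>x. \<omega> x \<ge> 0" "\<And>x. x \<in> E \<Longrightarrow> \<omega> x > 0"
  obtains G g where "open G" "E \<subseteq> G" "\<Lambda>'-lipschitz_on UNIV g"
    "\<And>x. f x - \<omega> x \<le> g x" "\<And>x. g x \<le> f x"
    "\<And>x v. closed_segment x (x + v) \<subseteq> G \<Longrightarrow> \<bar>g (x + v) - g x - e \<bullet> v\<bar> \<le> \<epsilon> * norm v"
proof -
  have \<Lambda>0: "\<Lambda> \<ge> 0"
    using f by (rule lipschitz_on_nonneg)
  define \<Lambda>1 where "\<Lambda>1 = (\<Lambda> + \<Lambda>') / 2"
  have \<Lambda>1: "\<Lambda> < \<Lambda>1" "\<Lambda>1 < \<Lambda>'"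
    using \<Lambda> by (auto simp: \<Lambda>1_def)
  define \<delta> where "\<delta> = min \<epsilon> (\<Lambda>' - \<Lambda>1)"
  have \<delta>: "\<delta> > 0" "\<delta> \<le> \<epsilon>" "\<Lambda>1 + \<delta> \<le> \<Lambda>'"
    using \<epsilon> \<Lambda>1 by (auto simp: \<delta>_def)
  obtain A :: "'a set" where A: "finite A" "A \<noteq> {}" "\<And>a. a \<in> A \<Longrightarrow> norm a \<le> \<Lambda>1"
    "\<And>w. \<exists>a\<in>A. a \<bullet> w \<le> - \<Lambda> * norm w"
    using finite_directions_below_cone[OF \<Lambda>0 \<Lambda>1(1)] by blast
  have "\<exists>G \<phi>. open G \<and> E \<subseteq> G \<and> (\<forall>x. 0 \<le> \<phi> x) \<and> (\<forall>x. \<phi> x \<le> \<omega> x) \<and>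
      (\<forall>x v. \<phi> (x + v) \<ge> \<phi> x + min 0 ((a - e) \<bullet> v) - \<delta> * norm v) \<and>
      (\<forall>x v. closed_segment x (x + v) \<subseteq> G \<longrightarrow> \<phi> (x + v) \<ge> \<phi> x + (a - e) \<bullet> v - \<delta> * norm v)" for a
    by (rule direction_potential[OF E \<delta>(1) \<omega>, of "a - e"]) blast+
  then obtain U \<phi> where U: "\<And>a. open (U a)" "\<And>a. E \<subseteq> U a"
    and \<phi>: "\<And>a x. 0 \<le> \<phi> a x" "\<And>a x. \<phi> a x \<le> \<omega> x"
    "\<And>a x v. \<phi> a (x + v) \<ge> \<phi> a x + min 0 ((a - e) \<bullet> v) - \<delta> * norm v"
    "\<And>a x v. closed_segment x (x + v) \<subseteq> U a \<Longrightarrow>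
       \<phi> a (x + v) \<ge> \<phi> a x + (a - e) \<bullet> v - \<delta> * norm v"
    by metis
  define G where "G = (\<Inter>a\<in>A. U a)"
  define h where "h x a y = f x + a \<bullet> (y - x) - \<phi> a y" for x a y
  define m where "m x y = Min ((\<lambda>a. h x a y) ` A)" for x y
  define g where "g y = (SUP x. m x y)" for y
  have m_le: "m x y \<le> h x a y" if "a \<in> A" for x y a
    unfolding m_def using A that by (intro Min_le) auto
  have m_attained: "\<exists>a\<in>A. m x y = h x a y" for x y
  proof -
    have "m x y \<in> (\<lambda>a. h x a y) ` A"
      unfolding m_def using A(1,2) by (intro Min_in) auto
    then show ?thesis by auto
  qed
  have m_le_f: "m x y \<le> f y" for x y
  proof -
    obtain a where a: "a \<in> A" "a \<bullet> (y - x) \<le> - \<Lambda> * norm (y - x)"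
      using A(4) by blast
    have "m x y \<le> h x a y"
      using a(1) by (rule m_le)
    also have "\<dots> \<le> f x - \<Lambda> * norm (y - x)"
      using a(2) \<phi>(1)[of a y] by (simp add: h_def)
    also have "\<dots> \<le> f y"
      using lipschitz_on_normD[OF f, of x y] by (simp add: norm_minus_commute)
    finally show ?thesis .
  qed
  have bdd: "bdd_above (range (\<lambda>x. m x y))" for y
    using m_le_f by (intro bdd_aboveI[of _ "f y"]) auto
  have m_le_g: "m x y \<le> g y" for x y
    unfolding g_def by (intro cSUP_upper bdd) simp
  have g_incr: "g (y + v) \<le> g y + k"
    if incr: "\<And>a. a \<in> A \<Longrightarrow> a \<bullet> v - \<phi> a (y + v) \<le> k - \<phi> a y" for y v k
    unfolding g_def[of "y + v"]
  proof (rule cSUP_least)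
    fix x
    obtain a where a: "a \<in> A" "m x y = h x a y"
      using m_attained by blast
    have "m x (y + v) \<le> h x a (y + v)"
      using a(1) by (rule m_le)
    also have "\<dots> \<le> h x a y + k"
      using incr[OF a(1)] by (simp add: h_def inner_diff_right inner_add_right)
    also have "\<dots> \<le> g y + k"
      using m_le_g[of x y] a(2) by simp
    finally show "m x (y + v) \<le> g y + k" .
  qed simp
  have g_lip: "g (y + v) \<le> g y + \<Lambda>' * norm v" for y v
  proof (rule g_incr)
    fix a assume a: "a \<in> A"
    have "a \<bullet> v \<le> \<Lambda>1 * norm v"
      using norm_cauchy_schwarz[of a v] A(3)[OF a] mult_right_mono[of "norm a" \<Lambda>1 "norm v"] by simp
    moreover have "e \<bullet> v \<le> \<Lambda>1 * norm v"
      using norm_cauchy_schwarz[of e v] e \<Lambda>1(1) mult_right_mono[of "norm e" \<Lambda>1 "norm v"] by simp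
    moreover have "\<Lambda>1 * norm v + \<delta> * norm v \<le> \<Lambda>' * norm v"
      using \<delta>(3) by (simp add: distrib_right[symmetric] mult_right_mono)
    ultimately show "a \<bullet> v - \<phi> a (y + v) \<le> \<Lambda>' * norm v - \<phi> a y"
      using \<phi>(3)[of a y v] by (simp add: inner_diff_left min_def split: if_splits)
  qed
  have g_grad: "g (y + v) \<le> g y + (e \<bullet> v + \<epsilon> * norm v)" if "closed_segment y (y + v) \<subseteq> G" for y v
  proof (rule g_incr)
    fix a assume "a \<in> A"
    then have "\<phi> a (y + v) \<ge> \<phi> a y + (a - e) \<bullet> v - \<delta> * norm v"
      using that by (intro \<phi>(4)) (auto simp: G_def)
    moreover have "\<delta> * norm v \<le> \<epsilon> * norm v"
      using \<delta>(2) by (simp add: mult_right_mono)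
    ultimately show "a \<bullet> v - \<phi> a (y + v) \<le> e \<bullet> v + \<epsilon> * norm v - \<phi> a y"
      by (simp add: inner_diff_left)
  qed
  show ?thesis
  proof (rule that)
    show "open G" "E \<subseteq> G"
      using U A(1) by (auto simp: G_def intro: open_INT)
    show "\<Lambda>'-lipschitz_on UNIV g"
    proof (rule lipschitz_onI)
      fix x y
      show "dist (g x) (g y) \<le> \<Lambda>' * dist x y"
        using g_lip[of x "y - x"] g_lip[of y "x - y"]
        by (simp add: dist_norm norm_minus_commute abs_le_iff)
    qed (use \<Lambda> \<Lambda>0 in simp)
    fix y
    show "g y \<le> f y"
      unfolding g_def using m_le_f by (intro cSUP_least) auto
    obtain a where "a \<in> A" "m y y = h y a y"
      using m_attained by blast
    then have "f y - \<omega> y \<le> m y y"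
      using \<phi>(2)[of a y] by (simp add: h_def)
    also have "\<dots> \<le> g y"
      by (rule m_le_g)
    finally show "f y - \<omega> y \<le> g y" .
  next
    fix x v
    assume seg: "closed_segment x (x + v) \<subseteq> G"
    have "g (x + v) \<le> g x + (e \<bullet> v + \<epsilon> * norm v)"
      using seg by (rule g_grad)
    moreover have "g x \<le> g (x + v) + (e \<bullet> (- v) + \<epsilon> * norm v)"
      using g_grad[of "x + v" "- v"] seg by (simp add: closed_segment_commute)
    ultimately show "\<bar>g (x + v) - g x - e \<bullet> v\<bar> \<le> \<epsilon> * norm v"
      by (simp add: abs_le_iff)
  qed
qed

lemma inner_radius_function:
  fixes G :: "'a::euclidean_space set"
  assumes "open G"
  obtains \<rho> where "1-lipschitz_on UNIV \<rho>" "\<And>x. 0 \<le> \<rho> x" "\<And>x. \<rho> x \<le> 1"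
    "\<And>x. x \<in> G \<Longrightarrow> 0 < \<rho> x" "\<And>x. ball x (\<rho> x) \<subseteq> G"
proof (cases "G = UNIV")
  case True
  show ?thesis
    by (rule that[of "\<lambda>_. 1"]) (auto simp: True intro: lipschitz_onI)
next
  case False
  define \<rho> where "\<rho> x = min 1 (infdist x (- G))" for x
  have ne: "- G \<noteq> {}"
    using False by auto
  show ?thesis
  proof (rule that[of \<rho>])
    show "1-lipschitz_on UNIV \<rho>"
    proof (rule lipschitz_onI)
      fix x y :: 'a
      have "\<bar>infdist x (- G) - infdist y (- G)\<bar> \<le> dist x y"
        using infdist_triangle_abs .
      then show "dist (\<rho> x) (\<rho> y) \<le> 1 * dist x y"
        by (auto simp: \<rho>_def dist_real_def min_def abs_if split: if_splits)
    qed simp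
    fix x
    show "0 \<le> \<rho> x" "\<rho> x \<le> 1"
      by (auto simp: \<rho>_def infdist_nonneg)
    show "0 < \<rho> x" if "x \<in> G"
      using that assms ne in_closed_iff_infdist_zero[of "- G" x] infdist_nonneg[of x "- G"]
      by (fastforce simp: \<rho>_def closed_Compl)
    show "ball x (\<rho> x) \<subseteq> G"
    proof (rule ccontr)
      assume "\<not> ball x (\<rho> x) \<subseteq> G"
      then obtain y where "dist x y < \<rho> x" "y \<in> - G"
        by (auto simp: subset_eq)
      then show False
        using infdist_le[of y "- G" x] by (auto simp: \<rho>_def)
    qed
  qed
qed

lemma prescribe_gradients:
  fixes E :: "'a::euclidean_space set" and e :: "nat \<Rightarrow> 'a"
  assumes E: "uniformly_thin E" and e: "\<And>k. norm (e k) \<le> 1 - (1 / 2) ^ k"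
  obtains F where "1-lipschitz_on UNIV F"
    "\<And>x k. x \<in> E \<Longrightarrow> \<exists>r. 0 < r \<and> r \<le> (1 / 2) ^ k \<and>
       (\<forall>y. norm y \<le> r \<longrightarrow> \<bar>F (x + y) - F x - e k \<bullet> y\<bar> \<le> 4 * (1 / 2) ^ k * r)"
proof -
  define P where "P k s \<longleftrightarrow> (1 - (1 / 2) ^ k)-lipschitz_on UNIV (fst s) \<and> 1-lipschitz_on UNIV (snd s) \<and>
      (\<forall>x. 0 \<le> snd s x \<and> snd s x \<le> 1) \<and> (\<forall>x\<in>E. 0 < snd s x)"
    for k :: nat and s :: "('a \<Rightarrow> real) \<times> ('a \<Rightarrow> real)"
  define Q where "Q k s t \<longleftrightarrow> (\<forall>x. snd t x \<le> snd s x) \<and>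
      (\<forall>x. fst s x - (1 / 4) ^ k * snd s x \<le> fst t x \<and> fst t x \<le> fst s x) \<and>
      (\<forall>x v. norm v < snd t x \<longrightarrow> \<bar>fst t (x + v) - fst t x - e k \<bullet> v\<bar> \<le> (1 / 2) ^ k * norm v)"
    for k :: nat and s t :: "('a \<Rightarrow> real) \<times> ('a \<Rightarrow> real)"
  have "\<exists>s. \<forall>k. P k (s k) \<and> Q k (s k) (s (Suc k))"
  proof (rule dependent_nat_choice)
    show "\<exists>s. P 0 s"
      by (rule exI[of _ "(\<lambda>_. 0, \<lambda>_. 1)"]) (auto simp: P_def intro: lipschitz_onI)
  next
    fix s k assume "P k s"
    then have f: "(1 - (1 / 2) ^ k)-lipschitz_on UNIV (fst s)" and \<rho>: "1-lipschitz_on UNIV (snd s)"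
      "\<And>x. 0 \<le> snd s x" "\<And>x. snd s x \<le> 1" "\<And>x. x \<in> E \<Longrightarrow> 0 < snd s x"
      by (auto simp: P_def)
    have \<omega>: "1-lipschitz_on UNIV (\<lambda>x. (1 / 4) ^ k * snd s x)"
    proof (rule lipschitz_onI)
      fix x y
      have "(1 / 4) ^ k * \<bar>snd s x - snd s y\<bar> \<le> 1 * \<bar>snd s x - snd s y\<bar>"
        by (intro mult_right_mono power_le_one) auto
      also have "\<dots> \<le> dist x y"
        using lipschitz_on_normD[OF \<rho>(1), of x y] by (simp add: dist_norm)
      finally show "dist ((1 / 4) ^ k * snd s x) ((1 / 4) ^ k * snd s y) \<le> 1 * dist x y"
        by (simp add: dist_real_def right_diff_distrib[symmetric] abs_mult)
    qed simp
    have \<omega>_pos: "(1 / 4) ^ k * snd s x \<ge> 0" "x \<in> E \<Longrightarrow> (1 / 4) ^ k * snd s x > 0" for x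
      using \<rho>(2,4) by auto
    have \<Lambda>: "1 - (1 / 2) ^ k < 1 - (1 / 2 :: real) ^ Suc k"
      by simp
    obtain G g where G: "open G" "E \<subseteq> G" and g: "(1 - (1 / 2) ^ Suc k)-lipschitz_on UNIV g"
      "\<And>x. fst s x - (1 / 4) ^ k * snd s x \<le> g x" "\<And>x. g x \<le> fst s x"
      "\<And>x v. closed_segment x (x + v) \<subseteq> G \<Longrightarrow> \<bar>g (x + v) - g x - e k \<bullet> v\<bar> \<le> (1 / 2) ^ k * norm v"
      using prescribe_gradient[OF E f e \<Lambda> _ \<omega> \<omega>_pos, of "(1 / 2) ^ k"] by auto
    obtain \<rho>' where \<rho>': "1-lipschitz_on UNIV \<rho>'" "\<And>x. 0 \<le> \<rho>' x" "\<And>x. \<rho>' x \<le> 1"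
      "\<And>x. x \<in> G \<Longrightarrow> 0 < \<rho>' x" "\<And>x. ball x (\<rho>' x) \<subseteq> G"
      using inner_radius_function[OF G(1)] by blast
    have "1-lipschitz_on UNIV (\<lambda>x. min (snd s x) (\<rho>' x))"
    proof (rule lipschitz_onI)
      fix x y
      show "dist (min (snd s x) (\<rho>' x)) (min (snd s y) (\<rho>' y)) \<le> 1 * dist x y"
        using lipschitz_onD[OF \<rho>(1), of x y] lipschitz_onD[OF \<rho>'(1), of x y]
        by (auto simp: dist_real_def min_def abs_if split: if_splits)
    qed simp
    then have "P (Suc k) (g, \<lambda>x. min (snd s x) (\<rho>' x))"
      using g(1) \<rho> \<rho>' G(2) by (auto simp: P_def min_le_iff_disj)
    moreover have "closed_segment x (x + v) \<subseteq> G" if "norm v < \<rho>' x" for x v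
    proof -
      have "closed_segment x (x + v) \<subseteq> ball x (\<rho>' x)"
        using that le_less_trans[OF norm_ge_zero that]
        by (intro closed_segment_subset) (auto simp: dist_norm)
      then show ?thesis using \<rho>'(5) by blast
    qed
    then have "Q k s (g, \<lambda>x. min (snd s x) (\<rho>' x))"
      using g by (auto simp: Q_def)
    ultimately show "\<exists>t. P (Suc k) t \<and> Q k s t"
      by blast
  qed
  then obtain s where s: "\<And>k. P k (s k)" "\<And>k. Q k (s k) (s (Suc k))"
    by blast
  define f where "f k = fst (s k)" for k
  define \<rho> where "\<rho> k = snd (s k)" for k
  have f_lip: "(1 - (1 / 2) ^ k)-lipschitz_on UNIV (f k)" for k
    using s(1)[of k] by (simp add: P_def f_def)
  have \<rho>: "1-lipschitz_on UNIV (\<rho> k)" "0 \<le> \<rho> k x" "\<rho> k x \<le> 1" "x \<in> E \<Longrightarrow> 0 < \<rho> k x" for k x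
    using s(1)[of k] by (auto simp: P_def \<rho>_def)
  have \<rho>_Suc: "\<rho> (Suc k) x \<le> \<rho> k x" for k x
    using s(2)[of k] by (simp add: Q_def \<rho>_def)
  have f_Suc: "f k x - (1 / 4) ^ k * \<rho> k x \<le> f (Suc k) x" "f (Suc k) x \<le> f k x" for k x
    using s(2)[of k] by (auto simp: Q_def f_def \<rho>_def)
  have f_grad: "\<bar>f (Suc k) (x + v) - f (Suc k) x - e k \<bullet> v\<bar> \<le> (1 / 2) ^ k * norm v"
    if "norm v < \<rho> (Suc k) x" for k x v
    using s(2)[of k] that by (simp add: Q_def f_def \<rho>_def)
  have dec: "decseq (\<lambda>k. f k x)" for x
    using f_Suc(2) by (rule decseq_SucI)
  have \<rho>_dec: "\<rho> j x \<le> \<rho> k x" if "k \<le> j" for j k x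
    using lift_Suc_antimono_le[of "\<lambda>k. \<rho> k x", OF \<rho>_Suc that] .
  have f_diff: "f k x - f j x \<le> 4 / 3 * ((1 / 4) ^ k - (1 / 4) ^ j) * \<rho> k x" if "k \<le> j" for j k x
    using that
  proof (induction j rule: dec_induct)
    case (step j)
    have "f j x - f (Suc j) x \<le> (1 / 4) ^ j * \<rho> j x"
      using f_Suc(1)[of j x] by simp
    also have "\<dots> \<le> (1 / 4) ^ j * \<rho> k x"
      using \<rho>_dec[OF step(1)] by (intro mult_left_mono) auto
    finally show ?case
      using step.IH by (simp add: algebra_simps)
  qed simp
  have f_diff': "f k x - f j x \<le> 2 * (1 / 4) ^ k * \<rho> k x" for j k x
  proof (cases "k \<le> j")
    case True
    note f_diff[OF True, of x]
    also have "4 / 3 * ((1 / 4) ^ k - (1 / 4) ^ j) * \<rho> k x \<le> 2 * (1 / 4) ^ k * \<rho> k x"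
      using \<rho>(2) by (intro mult_right_mono) (auto simp: algebra_simps add_increasing2)
    finally show ?thesis .
  next
    case False
    then have "f k x \<le> f j x"
      using dec[of x] by (simp add: decseq_def)
    moreover have "2 * (1 / 4) ^ k * \<rho> k x \<ge> 0"
      using \<rho>(2) by simp
    ultimately show ?thesis by linarith
  qed
  have "\<exists>l. (\<lambda>k. f k x) \<longlonglongrightarrow> l" for x
  proof -
    have "f 0 x - 2 \<le> f j x" for j
      using f_diff'[of 0 x j] \<rho>(3)[of 0 x] by simp
    then show ?thesis
      using decseq_convergent[OF dec] by blast
  qed
  then obtain F where F: "\<And>x. (\<lambda>k. f k x) \<longlonglongrightarrow> F x"
    by metis
  have F_le: "F x \<le> f k x" for x k
    using decseq_ge[OF dec F] .
  have F_ge: "f k x - F x \<le> 2 * (1 / 4) ^ k * \<rho> k x" for x k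
    by (rule LIMSEQ_le_const2[OF tendsto_diff[OF tendsto_const F]]) (use f_diff' in auto)
  show ?thesis
  proof (rule that)
    show "1-lipschitz_on UNIV F"
    proof (rule lipschitz_onI)
      fix x y
      have "(\<lambda>k. dist (f k x) (f k y)) \<longlonglongrightarrow> dist (F x) (F y)"
        by (intro tendsto_dist F)
      moreover have "dist (f k x) (f k y) \<le> 1 * dist x y" for k
      proof -
        have "dist (f k x) (f k y) \<le> (1 - (1 / 2) ^ k) * dist x y"
          using lipschitz_onD[OF f_lip] by simp
        also have "\<dots> \<le> 1 * dist x y"
          by (intro mult_right_mono) auto
        finally show ?thesis .
      qed
      ultimately show "dist (F x) (F y) \<le> 1 * dist x y"
        by (intro LIMSEQ_le_const2) auto
    qed simp
    fix x k assume x: "x \<in> E"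
    define q :: real where "q = (1 / 2) ^ k"
    have q: "0 < q" "q \<le> 1" "(1 / 4) ^ Suc k = q * q / 4"
      by (auto simp: q_def power_le_one power_mult_distrib[symmetric])
    define R where "R = \<rho> (Suc k) x"
    have R: "0 < R" "R \<le> 1"
      using \<rho>(3,4) x by (auto simp: R_def)
    define r where "r = q * R / 2"
    have r: "0 < r" "r \<le> q" "r < R"
      using q R mult_left_mono[of R 1 q] mult_right_mono[of q 1 R] by (auto simp: r_def)
    have "\<bar>F (x + y) - F x - e k \<bullet> y\<bar> \<le> 4 * q * r" if y: "norm y \<le> r" for y
    proof -
      have "\<bar>f (Suc k) (x + y) - f (Suc k) x - e k \<bullet> y\<bar> \<le> q * norm y"
        unfolding q_def using y r(3) by (intro f_grad) (auto simp: R_def)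
      also have "\<dots> \<le> q * r"
        using y q by (intro mult_left_mono) auto
      finally have grad: "\<bar>f (Suc k) (x + y) - f (Suc k) x - e k \<bullet> y\<bar> \<le> q * r" .
      have "\<rho> (Suc k) (x + y) \<le> R + norm y"
        using lipschitz_on_normD[OF \<rho>(1)[of "Suc k"], of "x + y" x] by (simp add: R_def)
      then have "\<rho> (Suc k) (x + y) \<le> 2 * R"
        using y r by simp
      then have "2 * (q * q / 4) * \<rho> (Suc k) (x + y) \<le> 2 * (q * q / 4) * (2 * R)"
        by (rule mult_left_mono) simp
      then have near_y: "f (Suc k) (x + y) - F (x + y) \<le> 2 * (q * r)"
        using F_ge[of "Suc k" "x + y"] unfolding q(3) by (simp add: r_def)
      have near_x: "f (Suc k) x - F x \<le> q * r"
        using F_ge[of "Suc k" x] unfolding q(3) by (simp add: r_def R_def)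
      show ?thesis
        using grad near_x near_y F_le[of x "Suc k"] F_le[of "x + y" "Suc k"] by linarith
    qed
    then show "\<exists>r. 0 < r \<and> r \<le> (1 / 2) ^ k \<and>
        (\<forall>y. norm y \<le> r \<longrightarrow> \<bar>F (x + y) - F x - e k \<bullet> y\<bar> \<le> 4 * (1 / 2) ^ k * r)"
      using r unfolding q_def by blast
  qed
qed

lemma recurrent_dense_sequence_in_ball:
  obtains e :: "nat \<Rightarrow> 'a::euclidean_space" where "\<And>k. norm (e k) \<le> 1 - (1 / 2) ^ k"
    "\<And>x \<eta> N. norm x \<le> 1 \<Longrightarrow> \<eta> > 0 \<Longrightarrow> \<exists>k\<ge>N. norm (x - e k) < \<eta>"
proof -
  obtain D :: "'a set" where D: "countable D" "\<And>X. open X \<Longrightarrow> X \<noteq> {} \<Longrightarrow> \<exists>d\<in>D. d \<in> X"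
    using countable_dense_exists[where 'a = 'a] by blast
  define z where "z k = from_nat_into D (fst (prod_decode k))" for k
  define e where "e k = (if norm (z k) \<le> 1 - (1 / 2) ^ k then z k else 0)" for k
  show ?thesis
  proof (rule that[of e])
    show "norm (e k) \<le> 1 - (1 / 2) ^ k" for k
      by (simp add: e_def power_le_one)
    fix x :: 'a and \<eta> :: real and N :: nat
    assume x: "norm x \<le> 1" and \<eta>: "\<eta> > 0"
    define t where "t = min (1 / 2) (\<eta> / 2)"
    have t: "0 < t" "t \<le> 1 / 2" "t < \<eta>"
      using \<eta> by (auto simp: t_def)
    have "(1 - t) * norm x \<le> (1 - t) * 1"
      using x t by (intro mult_left_mono) auto
    also have "\<dots> < 1"
      using t by simp
    finally have "(1 - t) * norm x < 1" .
    moreover have "t * norm x \<le> t * 1"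
      using x t by (intro mult_left_mono) auto
    then have "t * norm x < \<eta>"
      using t by linarith
    moreover have "x - (1 - t) *\<^sub>R x = t *\<^sub>R x"
      by (simp add: algebra_simps)
    ultimately have "(1 - t) *\<^sub>R x \<in> ball x \<eta> \<inter> ball 0 1"
      using t by (simp add: dist_norm)
    then obtain d where "d \<in> D" "d \<in> ball x \<eta> \<inter> ball 0 1"
      using D(2)[of "ball x \<eta> \<inter> ball 0 1"] by blast
    then have d: "d \<in> D" "norm (x - d) < \<eta>" "norm d < 1"
      by (auto simp: dist_norm)
    obtain K where K: "(1 / 2) ^ K < 1 - norm d"
      using real_arch_pow_inv[of "1 - norm d" "1 / 2"] d(3) by auto
    define k where "k = prod_encode (to_nat_on D d, max K N)"
    have k: "max K N \<le> k"
      unfolding k_def by (rule le_prod_encode_2)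
    have "(1 / 2 :: real) ^ k \<le> (1 / 2) ^ K"
      using k by (intro power_decreasing) auto
    with K have "norm d \<le> 1 - (1 / 2) ^ k"
      by linarith
    moreover have "z k = d"
      using d(1) D(1) by (simp add: z_def k_def)
    ultimately have "e k = d"
      by (simp add: e_def)
    then show "\<exists>k\<ge>N. norm (x - e k) < \<eta>"
      using d(2) k by (intro exI[of _ k]) auto
  qed
qed

lemma dir_derivs_eq_of_recurrent_slope:
  fixes f :: "'a::real_inner \<Rightarrow> real"
  assumes lip: "1-lipschitz_on UNIV f"
    and slope: "\<And>e \<eta> b. norm e \<le> 1 \<Longrightarrow> \<eta> > 0 \<Longrightarrow> b > 0 \<Longrightarrow>
      \<exists>r. 0 < r \<and> r < b \<and> (\<forall>y. norm y \<le> r \<longrightarrow> \<bar>f (x + y) - f x - e \<bullet> y\<bar> \<le> \<eta> * r)"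
  shows "upper_dir_deriv f x y = ereal (norm y)" "lower_dir_deriv f x y = ereal (- norm y)"
proof -
  let ?q = "\<lambda>t. (f (x + t *\<^sub>R y) - f x) / t"
  have q_le: "\<bar>?q t\<bar> \<le> norm y" if "t > 0" for t
    using lipschitz_on_normD[OF lip, of "x + t *\<^sub>R y" x] that by (simp add: divide_le_eq mult.commute)
  have ev_q_le: "\<forall>\<^sub>F t in at_right 0. \<bar>?q t\<bar> \<le> norm y"
    unfolding eventually_at_right_field using q_le by (intro exI[of _ 1]) auto
  have approx: "\<exists>t. 0 < t \<and> t < b \<and> \<bar>?q t - \<sigma> * norm y\<bar> \<le> \<eta>"
    if \<sigma>: "\<bar>\<sigma>\<bar> = 1" and \<eta>b: "\<eta> > 0" "b > 0" and y: "y \<noteq> 0" for \<sigma> \<eta> b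
  proof -
    have ny: "norm y > 0"
      using y by simp
    define e where "e = (\<sigma> / norm y) *\<^sub>R y"
    have "norm e \<le> 1"
      using \<sigma> ny by (simp add: e_def)
    then obtain r where r: "0 < r" "r < b * norm y"
      "\<And>w. norm w \<le> r \<Longrightarrow> \<bar>f (x + w) - f x - e \<bullet> w\<bar> \<le> \<eta> / norm y * r"
      using slope[of e "\<eta> / norm y" "b * norm y"] \<eta>b ny by auto
    define t where "t = r / norm y"
    have t: "0 < t" "t < b" "r = t * norm y"
      using r(1,2) ny by (auto simp: t_def divide_less_eq)
    have "e \<bullet> (t *\<^sub>R y) = t * (\<sigma> * norm y)"
      using ny by (simp add: e_def power2_norm_eq_inner[symmetric] power2_eq_square)
    then have "\<bar>f (x + t *\<^sub>R y) - f x - t * (\<sigma> * norm y)\<bar> \<le> \<eta> * t"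
      using r(3)[of "t *\<^sub>R y"] t(1,3) ny by simp
    moreover have "?q t - \<sigma> * norm y = (f (x + t *\<^sub>R y) - f x - t * (\<sigma> * norm y)) / t"
      using t(1) by (simp add: diff_divide_distrib)
    ultimately have "\<bar>?q t - \<sigma> * norm y\<bar> \<le> \<eta>"
      using t(1) by (simp add: divide_le_eq)
    with t show ?thesis by blast
  qed
  show "upper_dir_deriv f x y = ereal (norm y)"
  proof (rule antisym)
    show "upper_dir_deriv f x y \<le> ereal (norm y)"
      unfolding upper_dir_deriv_def
      by (rule Limsup_bounded, rule eventually_mono[OF ev_q_le]) (metis abs_le_D1 ereal_less_eq(3))
    show "ereal (norm y) \<le> upper_dir_deriv f x y"
    proof (rule ccontr)
      assume "\<not> ereal (norm y) \<le> upper_dir_deriv f x y"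
      then obtain c where "upper_dir_deriv f x y < ereal c" "ereal c < ereal (norm y)"
        unfolding not_le using ereal_dense2 by blast
      then have c: "upper_dir_deriv f x y < ereal c" "c < norm y"
        by auto
      from c(1) have "\<forall>\<^sub>F t in at_right 0. ereal (?q t) < ereal c"
        unfolding upper_dir_deriv_def by (intro Limsup_lessD)
      then obtain b where b: "b > 0" "\<And>t. 0 < t \<Longrightarrow> t < b \<Longrightarrow> ?q t < c"
        by (auto simp: eventually_at_right_field)
      show False
      proof (cases "y = 0")
        case True
        then show False
          using b(2)[of "b / 2"] b(1) c(2) by simp
      next
        case False
        then show False
          using approx[of 1 "norm y - c" b] b c(2) by force
      qed
    qed
  qed
  show "lower_dir_deriv f x y = ereal (- norm y)"
  proof (rule antisym)
    show "ereal (- norm y) \<le> lower_dir_deriv f x y"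
      unfolding lower_dir_deriv_def
      by (rule Liminf_bounded, rule eventually_mono[OF ev_q_le]) (metis abs_le_D2 ereal_less_eq(3) minus_le_iff)
    show "lower_dir_deriv f x y \<le> ereal (- norm y)"
    proof (rule ccontr)
      assume "\<not> lower_dir_deriv f x y \<le> ereal (- norm y)"
      then obtain c where "ereal c < lower_dir_deriv f x y" "ereal (- norm y) < ereal c"
        unfolding not_le using ereal_dense2 by blast
      then have c: "ereal c < lower_dir_deriv f x y" "- norm y < c"
        by auto
      from c(1) have "\<forall>\<^sub>F t in at_right 0. ereal c < ereal (?q t)"
        unfolding lower_dir_deriv_def by (intro less_LiminfD)
      then obtain b where b: "b > 0" "\<And>t. 0 < t \<Longrightarrow> t < b \<Longrightarrow> c < ?q t"
        by (auto simp: eventually_at_right_field)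
      show False
      proof (cases "y = 0")
        case True
        then show False
          using b(2)[of "b / 2"] b(1) c(2) by simp
      next
        case False
        then show False
          using approx[of "- 1" "norm y + c" b] b c(2) by force
      qed
    qed
  qed
qed

lemma Liminf_sup_eq_0_of_recurrent_slope:
  fixes f :: "'a::real_inner \<Rightarrow> real"
  assumes slope: "\<And>\<eta> b. \<eta> > 0 \<Longrightarrow> b > 0 \<Longrightarrow>
      \<exists>r. 0 < r \<and> r < b \<and> (\<forall>y. norm y \<le> r \<longrightarrow> \<bar>f (x + y) - f x - e \<bullet> y\<bar> \<le> \<eta> * r)"
  shows "Liminf (at_right 0)
      (\<lambda>r::real. SUP y\<in>{y. norm y \<le> r}. ereal (\<bar>f (x + y) - f x - e \<bullet> y\<bar> / r)) = 0"
    (is "Liminf _ ?S = 0")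
proof (rule antisym)
  have "0 \<le> ?S r" if "r > 0" for r
    using that by (intro SUP_upper2[of 0]) auto
  then have "\<forall>\<^sub>F r in at_right 0. 0 \<le> ?S r"
    unfolding eventually_at_right_field by (intro exI[of _ 1]) auto
  then show "0 \<le> Liminf (at_right 0) ?S"
    by (rule Liminf_bounded)
  show "Liminf (at_right 0) ?S \<le> 0"
  proof (rule ccontr)
    assume "\<not> Liminf (at_right 0) ?S \<le> 0"
    then have "0 < Liminf (at_right 0) ?S"
      by (simp only: not_le)
    then obtain c where "0 < ereal c" and c_less: "ereal c < Liminf (at_right 0) ?S"
      using ereal_dense2 by blast
    then have c: "0 < c"
      by simp
    from less_LiminfD[OF c_less] obtain b where b: "b > 0" "\<And>r. 0 < r \<Longrightarrow> r < b \<Longrightarrow> ereal c < ?S r"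
      by (auto simp: eventually_at_right_field)
    obtain r where r: "0 < r" "r < b"
      "\<And>y. norm y \<le> r \<Longrightarrow> \<bar>f (x + y) - f x - e \<bullet> y\<bar> \<le> c * r"
      using slope[OF c b(1)] by blast
    have "?S r \<le> ereal c"
      using r(1,3) by (intro SUP_least) (auto simp: divide_le_eq)
    with b(2)[OF r(1,2)] show False by simp
  qed
qed

theorem theorem1p13:
  fixes E :: "(real ^ 'n) set"
  assumes "uniformly_purely_unrectifiable E"
  shows "\<exists>f :: real ^ 'n \<Rightarrow> real.
           1-lipschitz_on UNIV f \<and>
           (\<forall>x\<in>E. \<forall>e. norm e \<le> 1 \<longrightarrow>
              Liminf (at_right 0)
                (\<lambda>r::real. SUP y\<in>{y. norm y \<le> r}. ereal (\<bar>f (x + y) - f x - e \<bullet> y\<bar> / r)) = 0) \<and>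
           (\<forall>x\<in>E. \<forall>y. upper_dir_deriv f x y = ereal (norm y) \<and>
                       lower_dir_deriv f x y = ereal (- norm y))"
proof -
  have E: "uniformly_thin E"
    using thin_of_uniformly_purely_unrectifiable[OF assms] by (simp add: uniformly_thin_def)
  obtain a :: "nat \<Rightarrow> real ^ 'n" where a: "\<And>k. norm (a k) \<le> 1 - (1 / 2) ^ k"
    "\<And>x \<eta> N. norm x \<le> 1 \<Longrightarrow> \<eta> > 0 \<Longrightarrow> \<exists>k\<ge>N. norm (x - a k) < \<eta>"
    using recurrent_dense_sequence_in_ball by blast
  obtain f where lip: "1-lipschitz_on UNIV f"
    and f: "\<And>x k. x \<in> E \<Longrightarrow> \<exists>r. 0 < r \<and> r \<le> (1 / 2) ^ k \<and>
       (\<forall>y. norm y \<le> r \<longrightarrow> \<bar>f (x + y) - f x - a k \<bullet> y\<bar> \<le> 4 * (1 / 2) ^ k * r)"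
    using prescribe_gradients[OF E a(1)] by blast
  have slope: "\<exists>r. 0 < r \<and> r < b \<and> (\<forall>y. norm y \<le> r \<longrightarrow> \<bar>f (x + y) - f x - e \<bullet> y\<bar> \<le> \<eta> * r)"
    if x: "x \<in> E" and e: "norm e \<le> 1" and \<eta>: "\<eta> > 0" and b: "b > 0" for x e \<eta> b
  proof -
    obtain N where N: "(1 / 2) ^ N < min b (\<eta> / 8)"
      using real_arch_pow_inv[of "min b (\<eta> / 8)" "1 / 2"] \<eta> b by auto
    obtain k where k: "k \<ge> N" "norm (e - a k) < \<eta> / 2"
      using a(2)[OF e, of "\<eta> / 2" N] \<eta> by auto
    have "(1 / 2 :: real) ^ k \<le> (1 / 2) ^ N"
      using k(1) by (intro power_decreasing) auto
    with N have q: "(1 / 2) ^ k < b" "4 * (1 / 2) ^ k \<le> \<eta> / 2"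
      by linarith+
    obtain r where r: "0 < r" "r \<le> (1 / 2) ^ k"
      "\<And>y. norm y \<le> r \<Longrightarrow> \<bar>f (x + y) - f x - a k \<bullet> y\<bar> \<le> 4 * (1 / 2) ^ k * r"
      using f[OF x] by blast
    have "\<bar>f (x + y) - f x - e \<bullet> y\<bar> \<le> \<eta> * r" if y: "norm y \<le> r" for y
    proof -
      have "\<bar>f (x + y) - f x - a k \<bullet> y\<bar> \<le> \<eta> / 2 * r"
        using r(3)[OF y] mult_right_mono[OF q(2), of r] r(1) by linarith
      moreover have "\<bar>(e - a k) \<bullet> y\<bar> \<le> \<eta> / 2 * r"
        using Cauchy_Schwarz_ineq2[of "e - a k" y] k(2) y \<eta>
          mult_mono[of "norm (e - a k)" "\<eta> / 2" "norm y" r] by simp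
      ultimately show ?thesis
        unfolding inner_diff_left by linarith
    qed
    with r q(1) show ?thesis by force
  qed
  show ?thesis
    using lip Liminf_sup_eq_0_of_recurrent_slope[OF slope] dir_derivs_eq_of_recurrent_slope[OF lip slope]
    by (intro exI[of _ f]) auto
qed

end
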